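(* Let $n \geq 5$ and let $s, t \in \{1, 2, \ldots, \lfloor \frac{n}{2}\rfloor\}$ with $s \neq t$ be such that $n \notin \{2s, 2t, 2(s+t)\}$, $3s \neq t$, $3t \neq s$, and ($3s = 5t$ or $3t = 5s$). Then each connected component of $\mathcal{N}(C_n(s,t))$ is homotopy equivalent to (A) a garland of $2$-dimensional spheres $S^2$, if $5s = 3t$ and $n = 4t$ (or $5t = 3s$ and $n = 4s$); (B) $S^2 \vee S^2$, if $5s = 3t$ and $n = 4s$ (or $5t = 3s$ and $n = 4t$); (C) a wedge sum of circles, if $5s = 3t$ and one of $6s$ or $\frac{14s}{3}$ is equal to $n$ (or $5t = 3s$ and one of $6t$ or $\frac{14t}{3}$ is equal to $n$); (D) a connected sum of tori, if $5s = 3t$ and $4s, 6s, \frac{14s}{3}, 4t \neq n$ (or $5t = 3s$ and $4t, 6t, \frac{14t}{3}, 4s \neq n$).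
   Context: The circulant graph $C_n(s,t)$ is the simple graph with vertex set $\{1,2,\ldots,n\}$ in which two vertices $x,y$ are adjacent if and only if $x-y \pmod n$ lies in $\{s, t, n-s, n-t\}$. The neighborhood complex $\mathcal{N}(G)$ of a graph $G$ is the (abstract) simplicial complex whose vertices are all non-isolated vertices of $G$ and whose simplices are those subsets of $V(G)$ which have a common neighbor in $G$. Topological statements about a simplicial complex refer to its geometric realization. Garland: a topological space $X = \bigcup_{i=1}^{m} X_i$ is said to be a garland of $X_1,\ldots,X_m$ if, for all $1 \le i \ne j \le m$, $|X_i \cap X_j| = 1$ when $i-j \equiv \pm 1 \pmod m$ and $X_i \cap X_j = \emptyset$ when $i-j \not\equiv \pm 1 \pmod m$. A garland of $2$-dimensional spheres is a garland of some $X_1,\ldots,X_m$ with every $X_i$ homeomorphic to $S^2$. A wedge sum of circles means a wedge of at least one circle. A connected sum of tori means a connected sum of one or more tori $S^1\times S^1$ (a single torus is allowed). *)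

theory Defs
  imports "HOL-Analysis.Analysis" "HOL-Number_Theory.Cong"
begin

section \<open>Circulant graphs\<close>

text \<open>A simple graph is a vertex set together with a symmetric irreflexive adjacency relation.\<close>

type_synonym 'v graph = "'v set \<times> ('v \<Rightarrow> 'v \<Rightarrow> bool)"

abbreviation verts :: "'v graph \<Rightarrow> 'v set" where "verts G \<equiv> fst G"
abbreviation adj :: "'v graph \<Rightarrow> 'v \<Rightarrow> 'v \<Rightarrow> bool" where "adj G \<equiv> snd G"

definition circulant_graph :: "nat \<Rightarrow> nat \<Rightarrow> nat \<Rightarrow> nat graph" where
  "circulant_graph n s t =
     ({1..n},
      \<lambda>x y. x \<in> {1..n} \<and> y \<in> {1..n} \<and>
        (int x - int y) mod int n \<in> {int s, int t, int n - int s, int n - int t})"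

lemma circulant_graph_simple:
  assumes s: "s \<in> {1..n div 2}" and t: "t \<in> {1..n div 2}"
  shows "\<not> adj (circulant_graph n s t) x x"
    and "adj (circulant_graph n s t) x y \<longleftrightarrow> adj (circulant_graph n s t) y x"
proof -
  have b: "0 < int s" "int s < int n" "0 < int t" "int t < int n"
    using s t by auto
  show "\<not> adj (circulant_graph n s t) x x"
    using b by (auto simp: circulant_graph_def)
  have *: "(v - u) mod int n \<in> {int s, int t, int n - int s, int n - int t}"
    if h: "(u - v) mod int n \<in> {int s, int t, int n - int s, int n - int t}" for u v :: int
  proof -
    have "(v - u) mod int n = (- ((u - v) mod int n)) mod int n"
      by (simp add: mod_minus_eq)
    also have "\<dots> = (if (u - v) mod int n = 0 then 0 else int n - (u - v) mod int n)"
      by (simp add: zmod_zminus1_eq_if)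
    finally show ?thesis using h b by auto
  qed
  show "adj (circulant_graph n s t) x y \<longleftrightarrow> adj (circulant_graph n s t) y x"
    using *[of "int x" "int y"] *[of "int y" "int x"]
    by (auto simp: circulant_graph_def)
qed


section \<open>Neighborhood complexes and geometric realizations\<close>

text \<open>An abstract simplicial complex is given by its family of nonempty simplices. Its vertices are
  the points \<open>v\<close> such that \<open>{v}\<close> is a simplex; for the neighborhood complex these are exactly the
  non-isolated vertices of the graph.\<close>

definition neighborhood_complex :: "'v graph \<Rightarrow> 'v set set" where
  "neighborhood_complex G =
     {\<sigma>. finite \<sigma> \<and> \<sigma> \<noteq> {} \<and> \<sigma> \<subseteq> verts G \<and> (\<exists>w\<in>verts G. \<forall>v\<in>\<sigma>. adj G v w)}"

text \<open>Points are given by barycentric coordinates. The topology is that of pointwise convergence of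
  the coordinates, which for a finite complex agrees with the weak topology.\<close>

definition geometric_realization :: "'v set set \<Rightarrow> ('v \<Rightarrow> real) topology" where
  "geometric_realization K =
     subtopology (powertop_real UNIV)
       {x. (\<forall>v. 0 \<le> x v) \<and> {v. x v \<noteq> 0} \<in> K \<and> (\<Sum>v\<in>{v. x v \<noteq> 0}. x v) = 1}"

definition component_spaces :: "'a topology \<Rightarrow> 'a topology set" where
  "component_spaces X = subtopology X ` connected_components_of X"


section \<open>Quotients, wedge sums, connected sums\<close>

definition quotient_topology :: "'a topology \<Rightarrow> ('a \<times> 'a) set \<Rightarrow> 'a set topology" where
  "quotient_topology X r = topology (\<lambda>U. U \<subseteq> topspace X // r \<and> openin X (topspace X \<inter> \<Union>U))"

lemma openin_quotient_topology:
  assumes "equiv (topspace X) r"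
  shows "openin (quotient_topology X r) U \<longleftrightarrow>
           U \<subseteq> topspace X // r \<and> openin X (topspace X \<inter> \<Union>U)"
proof -
  have "istopology (\<lambda>U. U \<subseteq> topspace X // r \<and> openin X (topspace X \<inter> \<Union>U))"
    unfolding istopology_def
  proof (rule conjI; intro allI impI)
    fix S T
    assume S: "S \<subseteq> topspace X // r \<and> openin X (topspace X \<inter> \<Union>S)"
      and T: "T \<subseteq> topspace X // r \<and> openin X (topspace X \<inter> \<Union>T)"
    have "\<Union>(S \<inter> T) = \<Union>S \<inter> \<Union>T"
    proof
      show "\<Union>S \<inter> \<Union>T \<subseteq> \<Union>(S \<inter> T)"
      proof
        fix x assume "x \<in> \<Union>S \<inter> \<Union>T"
        then obtain A B where AB: "A \<in> S" "x \<in> A" "B \<in> T" "x \<in> B" by auto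
        then have "A = B"
          using quotient_disj[OF assms, of A B] S T by blast
        then show "x \<in> \<Union>(S \<inter> T)" using AB by auto
      qed
    qed auto
    then have "topspace X \<inter> \<Union>(S \<inter> T) = (topspace X \<inter> \<Union>S) \<inter> (topspace X \<inter> \<Union>T)" by auto
    then show "S \<inter> T \<subseteq> topspace X // r \<and> openin X (topspace X \<inter> \<Union>(S \<inter> T))"
      using S T by auto
  next
    fix \<U>
    assume U: "\<forall>S\<in>\<U>. S \<subseteq> topspace X // r \<and> openin X (topspace X \<inter> \<Union>S)"
    have "topspace X \<inter> \<Union>(\<Union>\<U>) = \<Union>((\<lambda>S. topspace X \<inter> \<Union>S) ` \<U>)" by auto
    moreover have "openin X (\<Union>((\<lambda>S. topspace X \<inter> \<Union>S) ` \<U>))"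
      using U by (intro openin_Union) auto
    ultimately show "\<Union>\<U> \<subseteq> topspace X // r \<and> openin X (topspace X \<inter> \<Union>(\<Union>\<U>))"
      using U by auto
  qed
  then show ?thesis
    by (simp add: quotient_topology_def topology_inverse')
qed

lemma topspace_quotient_topology:
  assumes "equiv (topspace X) r"
  shows "topspace (quotient_topology X r) = topspace X // r"
proof -
  have "openin (quotient_topology X r) (topspace X // r)"
    by (simp add: openin_quotient_topology[OF assms] Union_quotient[OF assms])
  then show ?thesis
    using openin_quotient_topology[OF assms] openin_subset openin_topspace by (metis subset_antisym)
qed

lemma quotient_map_quotient_topology:
  assumes "equiv (topspace X) r"
  shows "quotient_map X (quotient_topology X r) (\<lambda>x. r `` {x})"
  unfolding quotient_map_def topspace_quotient_topology[OF assms]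
proof (intro conjI allI impI)
  show "(\<lambda>x. r `` {x}) ` topspace X = topspace X // r"
    by (auto simp: quotient_def)
next
  fix U assume U: "U \<subseteq> topspace X // r"
  have "{x \<in> topspace X. r `` {x} \<in> U} = topspace X \<inter> \<Union>U"
  proof (intro set_eqI iffI)
    fix x assume "x \<in> {x \<in> topspace X. r `` {x} \<in> U}"
    then show "x \<in> topspace X \<inter> \<Union>U"
      using equiv_class_self[OF assms] by blast
  next
    fix x assume "x \<in> topspace X \<inter> \<Union>U"
    then obtain A where A: "A \<in> U" "x \<in> A" "x \<in> topspace X" by auto
    then obtain y where "y \<in> topspace X" "A = r `` {y}"
      using U by (auto simp: quotient_def)
    then have "A = r `` {x}"
      using A(2) equiv_class_eq[OF assms] by blast
    then show "x \<in> {x \<in> topspace X. r `` {x} \<in> U}" using A by auto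
  qed
  then show "openin X {x \<in> topspace X. r `` {x} \<in> U} = openin (quotient_topology X r) U"
    using U by (simp add: openin_quotient_topology[OF assms])
qed

text \<open>The wedge of the pointed spaces \<open>(X i, p i)\<close>, \<open>i \<in> I\<close>.\<close>

definition wedge_sum :: "'i set \<Rightarrow> ('i \<Rightarrow> 'a topology) \<Rightarrow> ('i \<Rightarrow> 'a) \<Rightarrow> ('i \<times> 'a) set topology" where
  "wedge_sum I X p =
     quotient_topology (sum_topology X I)
       (Id_on (topspace (sum_topology X I)) \<union> {((i, p i), (j, p j)) |i j. i \<in> I \<and> j \<in> I})"

lemma equiv_wedge_sum:
  assumes "\<And>i. i \<in> I \<Longrightarrow> p i \<in> topspace (X i)"
  shows "equiv (topspace (sum_topology X I))
     (Id_on (topspace (sum_topology X I)) \<union> {((i, p i), (j, p j)) |i j. i \<in> I \<and> j \<in> I})"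
  using assms by (auto simp: equiv_def refl_on_def sym_on_def trans_on_def)

text \<open>Wedges of spheres do not depend on the choice of base points up to homeomorphism; the first
  standard basis vector is used.\<close>

definition sphere_base :: "nat \<Rightarrow> real" where
  "sphere_base = (\<lambda>i. if i = 0 then 1 else 0)"

lemma sphere_base_in_nsphere: "sphere_base \<in> topspace (nsphere d)"
  by (simp add: nsphere sphere_base_def if_distrib[of "\<lambda>x. x ^ 2"] cong: if_cong)

definition wedge_of_spheres :: "nat \<Rightarrow> nat \<Rightarrow> (nat \<times> (nat \<Rightarrow> real)) set topology" where
  "wedge_of_spheres d k = wedge_sum {1..k} (\<lambda>_. nsphere d) (\<lambda>_. sphere_base)"

text \<open>\<open>P\<close> is a connected sum of the surfaces \<open>M\<close> and \<open>N\<close>: the interiors of embedded closed discs are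
  removed, and the boundary circles \<open>f ` sphere 0 1\<close> and \<open>g ` sphere 0 1\<close> are glued along
  \<open>f z \<sim> g z\<close>. In dimension two every embedded closed disc in a surface without boundary is tame, and
  every homeomorphism of the boundary circle extends to the disc, so neither a collar nor a separate
  gluing homeomorphism is needed.\<close>

definition is_connected_sum :: "'a topology \<Rightarrow> 'a topology \<Rightarrow> 'b topology \<Rightarrow> bool" where
  "is_connected_sum M N P \<longleftrightarrow>
     (\<exists>(f :: complex \<Rightarrow> 'a) (g :: complex \<Rightarrow> 'a).
        embedding_map (top_of_set (cball 0 1)) M f \<and>
        embedding_map (top_of_set (cball 0 1)) N g \<and>
        (let S = sum_topology
                   (\<lambda>b. if b then subtopology N (topspace N - g ` ball 0 1)
                        else subtopology M (topspace M - f ` ball 0 1)) UNIV;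
             G = {((False, f z), (True, g z)) |z. z \<in> sphere 0 1}
         in P homeomorphic_space quotient_topology S (Id_on (topspace S) \<union> G \<union> G\<inverse>)))"

definition torus :: "((nat \<Rightarrow> real) \<times> (nat \<Rightarrow> real)) topology" where
  "torus = prod_topology (nsphere 1) (nsphere 1)"

text \<open>Connected sums of one or more tori. The carrier type is fixed, but the topology on it is
  arbitrary; as the type has the cardinality of the continuum, every closed surface is homeomorphic to
  a topology of this type, so all iterated connected sums are covered.\<close>

inductive connected_sum_of_tori :: "((nat \<Rightarrow> real) \<times> (nat \<Rightarrow> real)) topology \<Rightarrow> bool" where
  single: "P homeomorphic_space torus \<Longrightarrow> connected_sum_of_tori P"
| add: "connected_sum_of_tori M \<Longrightarrow> is_connected_sum M torus P \<Longrightarrow> connected_sum_of_tori P"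


section \<open>Garlands\<close>

definition garland :: "'a topology \<Rightarrow> nat \<Rightarrow> (nat \<Rightarrow> 'a set) \<Rightarrow> bool" where
  "garland Y m X \<longleftrightarrow>
     1 \<le> m \<and> topspace Y = (\<Union>i\<in>{1..m}. X i) \<and>
     (\<forall>i\<in>{1..m}. \<forall>j\<in>{1..m}. i \<noteq> j \<longrightarrow>
        (if [int i - int j = 1] (mod int m) \<or> [int i - int j = - 1] (mod int m)
         then card (X i \<inter> X j) = 1 else X i \<inter> X j = {}))"

text \<open>Spaces are tacitly Hausdorff. This makes the compact pieces closed, so that the topology of the
  garland is the one glued from its pieces; without it, pathological non-Hausdorff topologies on the
  union would qualify.\<close>

definition garland_of_2_spheres :: "'a topology \<Rightarrow> bool" where
  "garland_of_2_spheres Y \<longleftrightarrow>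
     Hausdorff_space Y \<and>
     (\<exists>m X. garland Y m X \<and> (\<forall>i\<in>{1..m}. subtopology Y (X i) homeomorphic_space nsphere 2))"

end

theory Submission
  imports Defs
begin

text \<open>Write \<open>{s, t} = {3a, 5a}\<close> and \<open>m = n div gcd n (2a)\<close>. In units of \<open>2a\<close>, each component of the
  neighborhood complex is the complex on the residues modulo \<open>m\<close> whose facets are the tetrahedra
  \<open>{x, x + 1, x + 4, x + 5}\<close>, and the hypotheses force \<open>m \<ge> 6\<close> and \<open>m \<noteq> 8\<close>.

  For \<open>m \<ge> 11\<close> the edges \<open>{x + 1, x + 4}\<close> lie in a single tetrahedron each. Collapsing them leaves, for
  every \<open>x\<close>, a square with corners \<open>x\<close>, \<open>x + 1\<close>, \<open>x + 4\<close>, \<open>x + 5\<close> cut along a diagonal; these are the images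
  of the unit squares of the plane under \<open>(i, j) \<mapsto> i + 4j\<close>, so the result is the quotient of the
  plane by the lattice \<open>i + 4j \<equiv> 0 (mod m)\<close>, a single torus.

  The cases \<open>m = 6, 7, 9, 10\<close> give two spheres with a common point, a circle, a circle, and a garland
  of five spheres. They are finite: an explicit complex collapses both to the given complex
  and to the union of boundaries of simplices that realizes the target.\<close>

section \<open>Collapsing simplicial complexes\<close>

text \<open>The bound 11 is a wrap-around bound: two labels out of 0, 1, 4, 5 sum to at most 10, so
  for \<open>m >= 11\<close> a congruence between such sums is an equality, and simplices meet only
  where they meet in the plane modulo the lattice. Below 11 different sums can agree modulo
  \<open>m\<close>, and each remaining case needs its own treatment. Collapses of the given complex
  cannot suffice there, because the chosen targets use vertices that are not residues and hence are
  not subcomplexes; the way leads up to a larger complex and down again, along a certificate that is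
  checked by evaluation. The arithmetic of the cases: \<open>s\<close> and \<open>t\<close> are at
  most \<open>n div 2\<close>, so \<open>n >= 10a\<close>, and equality would make \<open>n\<close>
  twice the larger parameter. The value \<open>m = 8\<close> would come from
  \<open>n = 16a = 2(s + t)\<close>. If \<open>gcd n (2a)\<close> is a proper divisor of
  \<open>2a\<close>, it is at most \<open>a\<close>, and then \<open>m > 10\<close>. So a small
  \<open>m\<close> always comes with \<open>n = 2am\<close>, which gives the four exceptional values
  \<open>12a\<close>, \<open>14a\<close>, \<open>18a\<close>, \<open>20a\<close> of
  \<open>n\<close>.\<close>

abbreviation supp :: "('v \<Rightarrow> real) \<Rightarrow> 'v set" where
  "supp x \<equiv> {v. x v \<noteq> 0}"

definition realization_points :: "'v set set \<Rightarrow> ('v \<Rightarrow> real) set" where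
  "realization_points K = {x. (\<forall>v. 0 \<le> x v) \<and> supp x \<in> K \<and> (\<Sum>v\<in>supp x. x v) = 1}"

lemma geometric_realization_eq:
  "geometric_realization K = top_of_set (realization_points K)"
  by (simp add: geometric_realization_def realization_points_def euclidean_product_topology)

text \<open>The mass is summed over a fixed finite vertex set instead of the varying support, so
  that membership along a homotopy becomes a computation with finitely many coordinates.\<close>

lemma realization_points_iff:
  assumes "finite V" "\<Union>K \<subseteq> V"
  shows "x \<in> realization_points K \<longleftrightarrow>
    (\<forall>v. 0 \<le> x v) \<and> (\<forall>v. v \<notin> V \<longrightarrow> x v = 0) \<and> sum x V = 1 \<and> supp x \<in> K"
proof -
  have sum_eq: "sum x (supp x) = sum x V" if "supp x \<subseteq> V"
    using assms that by (intro sum.mono_neutral_left) auto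
  have "supp x \<subseteq> V" if "supp x \<in> K" using that assms by blast
  moreover have "supp x \<subseteq> V \<longleftrightarrow> (\<forall>v. v \<notin> V \<longrightarrow> x v = 0)" by auto
  ultimately show ?thesis
    unfolding realization_points_def mem_Collect_eq using sum_eq by auto
qed

definition down_closed :: "'v set set \<Rightarrow> bool" where
  "down_closed K \<longleftrightarrow> (\<forall>\<rho>\<in>K. \<forall>\<tau>. \<tau> \<noteq> {} \<longrightarrow> \<tau> \<subseteq> \<rho> \<longrightarrow> \<tau> \<in> K)"

lemma down_closedD: "down_closed K \<Longrightarrow> \<rho> \<in> K \<Longrightarrow> \<tau> \<subseteq> \<rho> \<Longrightarrow> \<tau> \<noteq> {} \<Longrightarrow> \<tau> \<in> K"
  by (auto simp: down_closed_def)

lemma continuous_on_Min: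
  fixes f :: "'i \<Rightarrow> 'a::topological_space \<Rightarrow> 'b::linorder_topology"
  assumes "finite I" "I \<noteq> {}" "\<And>i. i \<in> I \<Longrightarrow> continuous_on S (f i)"
  shows "continuous_on S (\<lambda>x. Min ((\<lambda>i. f i x) ` I))"
  using assms
proof (induction I rule: finite_ne_induct)
  case (insert i I)
  then show ?case by (simp add: continuous_on_min)
qed simp

text \<open>The retraction subtracts the smallest barycentric coordinate on \<open>\<sigma>\<close> from all coordinates on
  \<open>\<sigma>\<close> and moves the mass to \<open>v\<close>; the homotopy to the identity is linear.\<close>

lemma collapse:
  fixes K :: "'v set set"
  assumes fin: "finite (\<Union>K)" and dc: "down_closed K"
    and \<sigma>: "finite \<sigma>" "\<sigma> \<noteq> {}" and v: "v \<notin> \<sigma>"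
    and link: "\<And>\<rho>. \<rho> \<in> K \<Longrightarrow> \<sigma> \<subseteq> \<rho> \<Longrightarrow> insert v \<rho> \<in> K"
  shows "geometric_realization K homotopy_equivalent_space
         geometric_realization {\<rho> \<in> K. \<not> \<sigma> \<subseteq> \<rho>}"
proof -
  define L where "L = {\<rho> \<in> K. \<not> \<sigma> \<subseteq> \<rho>}"
  define V where "V = \<Union>K"
  have V: "finite V" "\<Union>K \<subseteq> V" "\<Union>L \<subseteq> V"
    using fin by (auto simp: V_def L_def)
  note iffK = realization_points_iff[OF V(1,2)] and iffL = realization_points_iff[OF V(1,3)]
  define \<mu> where "\<mu> x = Min (x ` \<sigma>)" for x :: "'v \<Rightarrow> real"
  define h where "h p = (\<lambda>u. snd p u + fst p * ((if u = v then real (card \<sigma>) else 0)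
      - (if u \<in> \<sigma> then 1 else 0)) * \<mu> (snd p))" for p :: "real \<times> ('v \<Rightarrow> real)"
  have mu_le: "\<mu> x \<le> x u" if "u \<in> \<sigma>" for x u
    using that \<sigma> by (simp add: \<mu>_def)
  have mu_in: "\<exists>u\<in>\<sigma>. \<mu> x = x u" for x
  proof -
    have "\<mu> x \<in> x ` \<sigma>" unfolding \<mu>_def using \<sigma> by (intro Min_in) auto
    then show ?thesis by auto
  qed
  have mu_nonneg: "0 \<le> \<mu> x" if "\<forall>u. 0 \<le> x u" for x
    using mu_in[of x] that by auto
  have mu_pos: "\<sigma> \<subseteq> supp x" if "\<mu> x \<noteq> 0" "\<forall>u. 0 \<le> x u" for x
    using mu_le[of _ x] mu_nonneg[of x] that by force
  have mu_0: "\<mu> x = 0" if "\<forall>u. 0 \<le> x u" "\<not> \<sigma> \<subseteq> supp x" for x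
    using mu_pos that by blast
  have h_0: "h (t, x) = x" if "\<mu> x = 0" for t x
    using that by (simp add: h_def)
  have hK: "h (t, x) \<in> realization_points K \<and> (t = 1 \<longrightarrow> h (t, x) \<in> realization_points L)"
    if t: "0 \<le> t" "t \<le> 1" and x: "x \<in> realization_points K" for t x
  proof (cases "\<sigma> \<subseteq> supp x")
    case False
    then have "h (t, x) = x" using x by (simp add: h_0 mu_0 iffK)
    moreover have "x \<in> realization_points L" using x False unfolding iffK iffL by (auto simp: L_def)
    ultimately show ?thesis using x by metis
  next
    case True
    define \<rho> where "\<rho> = supp x"
    have \<rho>: "\<rho> \<in> K" "\<sigma> \<subseteq> \<rho>" "insert v \<rho> \<in> K"
      using x True link by (auto simp: iffK \<rho>_def)
    then have sub: "\<sigma> \<subseteq> V" "v \<in> V" using V by auto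
    have x': "\<forall>u. 0 \<le> x u" "\<forall>u. u \<notin> V \<longrightarrow> x u = 0" "sum x V = 1" using x by (auto simp: iffK)
    have nonneg: "0 \<le> h (t, x) u" for u
    proof -
      have "t * \<mu> x \<le> \<mu> x" using t mu_nonneg[OF x'(1)] by (simp add: mult_left_le_one_le)
      then show ?thesis
        using mu_le[of u x] x'(1) v t mu_nonneg[OF x'(1)] by (auto simp: h_def algebra_simps)
    qed
    have sumh: "sum (h (t, x)) V = 1"
    proof -
      have "sum (h (t, x)) V = sum x V + t * (\<Sum>u\<in>V. (if u = v then real (card \<sigma>) else 0)
          - (if u \<in> \<sigma> then 1 else 0)) * \<mu> x"
        by (simp add: h_def sum.distrib sum_distrib_left sum_distrib_right)
      also have "(\<Sum>u\<in>V. (if u = v then real (card \<sigma>) else 0) - (if u \<in> \<sigma> then 1 else 0)) = 0"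
      proof -
        have "(\<Sum>u\<in>V. if u \<in> \<sigma> then 1 else 0) = real (card \<sigma>)"
          using V sub by (simp add: sum.If_cases Int_absorb1)
        then show ?thesis using V sub by (simp add: sum_subtractf)
      qed
      finally show ?thesis using x' by simp
    qed
    \<comment> \<open>The link of \<open>\<sigma>\<close> is a cone with apex \<open>v\<close>, so
      the whole motion of \<open>x\<close> stays inside the single simplex
      \<open>insert v \<rho>\<close> of \<open>K\<close>.\<close>
    have supp: "supp (h (t, x)) \<subseteq> insert v \<rho>"
      using \<rho> by (auto simp: h_def \<rho>_def)
    have "supp (h (t, x)) \<noteq> {}"
      using sumh by (metis (mono_tags, lifting) Collect_empty_eq sum.neutral zero_neq_one)
    then have inK: "supp (h (t, x)) \<in> K"
      using down_closedD[OF dc \<rho>(3) supp] by simp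
    have off: "\<forall>u. u \<notin> V \<longrightarrow> h (t, x) u = 0"
      using sub x' by (auto simp: h_def)
    have "\<not> \<sigma> \<subseteq> supp (h (t, x))" if "t = 1"
    proof -
      \<comment> \<open>At time 1 a vertex where the minimum is attained has lost all its mass; it
        differs from \<open>v\<close>, which only gains.\<close>
      obtain u where "u \<in> \<sigma>" "\<mu> x = x u" using mu_in by blast
      then have "h (t, x) u = 0" using v that by (auto simp: h_def)
      then show ?thesis using \<open>u \<in> \<sigma>\<close> by auto
    qed
    then have "h (t, x) \<in> realization_points L" if "t = 1"
      using nonneg sumh inK off that unfolding iffL by (simp add: L_def)
    then show ?thesis using nonneg sumh inK off by (simp add: iffK)
  qed
  have cont: "continuous_on S h" for S
  proof -
    have *: "continuous_on S (\<lambda>p. snd p u)" for u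
      by (rule continuous_on_product_then_coordinatewise[OF continuous_on_snd[OF continuous_on_id]])
    have "continuous_on S (\<lambda>p. \<mu> (snd p))"
      unfolding \<mu>_def using * by (intro continuous_on_Min \<sigma>)
    then show ?thesis
      unfolding h_def
      by (intro continuous_on_coordinatewise_then_product continuous_on_add continuous_on_mult
          continuous_on_const continuous_on_fst continuous_on_id *)
  qed
  have LK: "realization_points L \<subseteq> realization_points K"
    by (auto simp: realization_points_def L_def)
  let ?r = "\<lambda>x. h (1, x)"
  have contr: "continuous_on S ?r" for S
    using continuous_on_compose[OF continuous_on_Pair[OF continuous_on_const continuous_on_id] cont]
    by (simp add: o_def)
  have idL: "h (t, x) = x" if "x \<in> realization_points L" for t x
    using that unfolding iffL by (intro h_0 mu_0) (auto simp: L_def)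
  have hL: "?r x \<in> realization_points L" if "x \<in> realization_points K" for x
    using hK[of 1 x] that by simp
  have "homotopic_with (\<lambda>x. True) (geometric_realization K) (geometric_realization K) id ?r"
    unfolding homotopic_with_def geometric_realization_eq prod_topology_subtopology_eu
    by (intro exI[of _ h])
      (use hK cont in \<open>auto simp: h_def[of "(0, _)"]\<close>)
  moreover have "retraction_maps (geometric_realization K) (geometric_realization L) ?r id"
    unfolding retraction_maps_def geometric_realization_eq
    using hL contr LK idL by (auto simp: continuous_map_in_subtopology)
  ultimately show ?thesis
    unfolding L_def[symmetric]
    by (intro deformation_retract_imp_homotopy_equivalent_space) (simp add: homotopic_with_sym)+
qed

text \<open>A later collapse needs its simplices \<open>insert (v i) \<rho>\<close> to have survived
  the earlier ones. The second half of \<open>link\<close> ensures this, since such a simplex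
  contains no other \<open>\<sigma> j\<close>; the collapses can thus be done one by one in any
  order.\<close>

lemma disjoint_collapses:
  fixes K :: "'v set set"
  assumes fin: "finite (\<Union>K)" and dc: "down_closed K" and "finite I"
    and \<sigma>: "\<And>i. i \<in> I \<Longrightarrow> finite (\<sigma> i) \<and> \<sigma> i \<noteq> {} \<and> v i \<notin> \<sigma> i"
    and link: "\<And>i \<rho>. i \<in> I \<Longrightarrow> \<rho> \<in> K \<Longrightarrow> \<sigma> i \<subseteq> \<rho> \<Longrightarrow>
      insert (v i) \<rho> \<in> K \<and> (\<forall>j\<in>I. j \<noteq> i \<longrightarrow> \<not> \<sigma> j \<subseteq> insert (v i) \<rho>)"
  shows "geometric_realization K homotopy_equivalent_space
         geometric_realization {\<rho> \<in> K. \<forall>i\<in>I. \<not> \<sigma> i \<subseteq> \<rho>}"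
proof -
  have "geometric_realization K homotopy_equivalent_space
         geometric_realization {\<rho> \<in> K. \<forall>i\<in>J. \<not> \<sigma> i \<subseteq> \<rho>}" if "finite J" "J \<subseteq> I" for J
    using that
  proof (induction J rule: finite_induct)
    case empty
    then show ?case by (simp add: homotopy_equivalent_space_refl)
  next
    case (insert i J)
    let ?L = "{\<rho> \<in> K. \<forall>i\<in>J. \<not> \<sigma> i \<subseteq> \<rho>}"
    have "finite (\<Union>?L)" using fin by (rule finite_subset[rotated]) auto
    moreover have "down_closed ?L"
      using dc unfolding down_closed_def by (smt (verit, best) mem_Collect_eq subset_trans)
    ultimately have "geometric_realization ?L homotopy_equivalent_space
       geometric_realization {\<rho> \<in> ?L. \<not> \<sigma> i \<subseteq> \<rho>}"
    proof (rule collapse[where v = "v i"])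
      have i: "i \<in> I" using insert.prems by auto
      show "finite (\<sigma> i)" "\<sigma> i \<noteq> {}" "v i \<notin> \<sigma> i" using \<sigma>[OF i] by auto
      fix \<rho> assume "\<rho> \<in> ?L" "\<sigma> i \<subseteq> \<rho>"
      moreover from this have "insert (v i) \<rho> \<in> K \<and> (\<forall>j\<in>I. j \<noteq> i \<longrightarrow> \<not> \<sigma> j \<subseteq> insert (v i) \<rho>)"
        using link[OF i] by blast
      ultimately show "insert (v i) \<rho> \<in> ?L"
        using insert.prems insert.hyps by auto
    qed
    moreover have "{\<rho> \<in> ?L. \<not> \<sigma> i \<subseteq> \<rho>} = {\<rho> \<in> K. \<forall>i\<in>insert i J. \<not> \<sigma> i \<subseteq> \<rho>}" by auto
    ultimately show ?case using insert by (metis (no_types, lifting) homotopy_eqv_trans insert_subset)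
  qed
  then show ?thesis using \<open>finite I\<close> by blast
qed

section \<open>Collapsing complexes given by facets\<close>

definition complex_of :: "'v list list \<Rightarrow> 'v set set" where
  "complex_of Fs = {\<rho>. \<rho> \<noteq> {} \<and> (\<exists>F\<in>set Fs. \<rho> \<subseteq> set F)}"

lemma finite_complex_of: "finite (\<Union>(complex_of Fs))"
  by (rule finite_subset[of _ "\<Union>(set ` set Fs)"]) (auto simp: complex_of_def)

lemma down_closed_complex_of: "down_closed (complex_of Fs)"
  unfolding down_closed_def complex_of_def by blast

text \<open>An executable form of deleting the open star of \<open>\<sigma>\<close>: a facet
  containing \<open>\<sigma>\<close> gives way to its faces opposite to the vertices of
  \<open>\<sigma>\<close>. Dropping the faces that lie in a remaining facet does not change the
  complex and keeps the lists short.\<close>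

definition facets_without :: "'v list \<Rightarrow> 'v list list \<Rightarrow> 'v list list" where
  "facets_without \<sigma> Fs =
     (let Gs = filter (\<lambda>F. \<not> set \<sigma> \<subseteq> set F) Fs
      in Gs @ filter (\<lambda>F. \<forall>G\<in>set Gs. \<not> set F \<subseteq> set G)
           (concat (map (\<lambda>F. map (\<lambda>u. removeAll u F) \<sigma>) (filter (\<lambda>F. set \<sigma> \<subseteq> set F) Fs))))"

definition covered_by :: "'v list list \<Rightarrow> 'v list list \<Rightarrow> bool" where
  "covered_by Fs Gs \<longleftrightarrow> (\<forall>F\<in>set Fs. \<exists>G\<in>set Gs. set F \<subseteq> set G)"

text \<open>A certificate for a chain of collapses: each pair names the simplex to remove and an
  apex of its link. All conditions concern facets only, so evaluation decides them; the final
  comparison by mutual covering ignores order and redundant facets.\<close>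

fun collapses_to :: "('v list \<times> 'v) list \<Rightarrow> 'v list list \<Rightarrow> 'v list list \<Rightarrow> bool" where
  "collapses_to [] Fs Gs \<longleftrightarrow> covered_by Fs Gs \<and> covered_by Gs Fs"
| "collapses_to ((\<sigma>, v) # steps) Fs Gs \<longleftrightarrow>
     \<sigma> \<noteq> [] \<and> v \<notin> set \<sigma> \<and> 
     (\<forall>F\<in>set Fs. set \<sigma> \<subseteq> set F \<longrightarrow> (\<exists>G\<in>set Fs. set (v # F) \<subseteq> set G)) \<and>
     collapses_to steps (facets_without \<sigma> Fs) Gs"

lemma complex_of_mono: "covered_by Fs Gs \<Longrightarrow> complex_of Fs \<subseteq> complex_of Gs"
  unfolding covered_by_def complex_of_def by blast

text \<open>A face of \<open>F\<close> that does not contain \<open>\<sigma>\<close> misses some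
  \<open>u\<close> in \<open>\<sigma>\<close>, hence lies in \<open>F\<close> without
  \<open>u\<close>; that face is either listed or covered by a kept facet.\<close>

lemma complex_of_facets_without:
  assumes "\<sigma> \<noteq> []"
  shows "complex_of (facets_without \<sigma> Fs) = {\<rho> \<in> complex_of Fs. \<not> set \<sigma> \<subseteq> \<rho>}"
proof (intro equalityI subsetI)
  fix \<rho> assume "\<rho> \<in> complex_of (facets_without \<sigma> Fs)"
  then obtain G where G: "\<rho> \<noteq> {}" "\<rho> \<subseteq> set G" "G \<in> set (facets_without \<sigma> Fs)"
    unfolding complex_of_def by blast
  then obtain F where "F \<in> set Fs" "set G \<subseteq> set F" "\<not> set \<sigma> \<subseteq> set G"
    by (fastforce simp: facets_without_def Let_def)
  with G show "\<rho> \<in> {\<rho> \<in> complex_of Fs. \<not> set \<sigma> \<subseteq> \<rho>}"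
    unfolding complex_of_def by blast
next
  fix \<rho> assume "\<rho> \<in> {\<rho> \<in> complex_of Fs. \<not> set \<sigma> \<subseteq> \<rho>}"
  then obtain F u where F: "F \<in> set Fs" "\<rho> \<noteq> {}" "\<rho> \<subseteq> set F" and u: "u \<in> set \<sigma>" "u \<notin> \<rho>"
    unfolding complex_of_def by blast
  have "\<exists>G\<in>set (facets_without \<sigma> Fs). \<rho> \<subseteq> set G"
  proof (cases "set \<sigma> \<subseteq> set F")
    case False
    then show ?thesis using F by (auto simp: facets_without_def Let_def)
  next
    case True
    have sub: "\<rho> \<subseteq> set (removeAll u F)" using F u by auto
    show ?thesis
    proof (cases "\<exists>G\<in>set Fs. \<not> set \<sigma> \<subseteq> set G \<and> set (removeAll u F) \<subseteq> set G")
      case True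
      then obtain G where "G \<in> set Fs" "\<not> set \<sigma> \<subseteq> set G" "\<rho> \<subseteq> set G" using sub by blast
      then show ?thesis by (auto simp: facets_without_def Let_def)
    next
      case False
      then have "removeAll u F \<in> set (facets_without \<sigma> Fs)"
        using F u True by (auto simp: facets_without_def Let_def)
      then show ?thesis using sub by blast
    qed
  qed
  then show "\<rho> \<in> complex_of (facets_without \<sigma> Fs)"
    using F by (auto simp: complex_of_def)
qed

lemma collapses_to_homotopy_equivalent:
  "collapses_to steps Fs Gs \<Longrightarrow>
     geometric_realization (complex_of Fs) homotopy_equivalent_space geometric_realization (complex_of Gs)"
proof (induction steps Fs Gs rule: collapses_to.induct)
  case (1 Fs Gs)
  then have "complex_of Fs = complex_of Gs" using complex_of_mono by auto
  then show ?case by (simp add: homotopy_equivalent_space_refl)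
next
  case (2 \<sigma> v steps Fs Gs)
  \<comment> \<open>The apex condition passes from facets to all simplices: if \<open>\<rho>\<close>
    is a face of \<open>F\<close> and \<open>G\<close> contains \<open>F\<close> and
    \<open>v\<close>, then \<open>G\<close> contains \<open>insert v \<rho>\<close>.\<close>
  have link: "insert v \<rho> \<in> complex_of Fs" if \<rho>: "\<rho> \<in> complex_of Fs" "set \<sigma> \<subseteq> \<rho>" for \<rho>
  proof -
    obtain F where F: "F \<in> set Fs" "\<rho> \<subseteq> set F" using \<rho> by (auto simp: complex_of_def)
    then obtain G where "G \<in> set Fs" "set (v # F) \<subseteq> set G"
      using 2(2) \<rho>(2) by (meson collapses_to.simps(2) order_trans)
    then show ?thesis using F by (auto simp: complex_of_def)
  qed
  have "geometric_realization (complex_of Fs) homotopy_equivalent_space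
      geometric_realization {\<rho> \<in> complex_of Fs. \<not> set \<sigma> \<subseteq> \<rho>}"
    using 2(2) link by (intro collapse[where v = v] finite_complex_of down_closed_complex_of) auto
  then show ?case
    using 2 complex_of_facets_without[of \<sigma> Fs] by (metis collapses_to.simps(2) homotopy_eqv_trans)
qed

lemma common_expansion:
  assumes "collapses_to p Bs Fs" "collapses_to q Bs Gs"
  shows "geometric_realization (complex_of Fs) homotopy_equivalent_space
         geometric_realization (complex_of Gs)"
  using assms collapses_to_homotopy_equivalent homotopy_equivalent_space_sym homotopy_eqv_trans by blast

definition boundary_facets :: "'v list \<Rightarrow> 'v list list" where
  "boundary_facets vs = map (\<lambda>u. removeAll u vs) vs"

text \<open>Each component of the neighborhood complex of \<open>C\<^sub>n(3a, 5a)\<close> is this complex: the vertex \<open>k\<close>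
  stands for \<open>x\<^sub>0 + 2ak\<close>, and the neighborhood of \<open>w\<close> is \<open>{x, x + 2a, x + 8a, x + 10a}\<close> with
  \<open>x = w - 5a\<close>.\<close>

definition circulant_facets :: "nat \<Rightarrow> nat list list" where
  "circulant_facets m = map (\<lambda>x. [x, (x + 1) mod m, (x + 4) mod m, (x + 5) mod m]) [0..<m]"

text \<open>In the four cases below, the common expansion \<open>B\<close> arises from the complex by adding cones over
  contractible subcomplexes; the cone points are the vertices that are not residues modulo \<open>m\<close>.\<close>

lemma circulant_facets_6:
  "geometric_realization (complex_of (circulant_facets 6)) homotopy_equivalent_space
   geometric_realization (complex_of (concat (map boundary_facets [[0,1,2,6],
       [2,4,5,7]]) :: nat list list))"
proof (rule common_expansion)
  let ?B = "[[0,1,2,3], [0,1,2,5], [0,1,4,5], [0,1,4,6], [0,1,5,6], [0,2,3,6], [0,3,4,5], [0,3,5,6],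
      [0,4,5,6], [1,2,3,4], [1,2,3,6], [1,2,5,6], [1,3,4,6], [2,3,4,5], [2,3,4,6], [2,4,6,7],
      [2,5,6,7], [3,4,5,6], [4,5,6,7]] :: nat list list"
  \<comment> \<open>The vertex 7 is a cone point over the three triangles around 6 with boundary 2,
    4, 5. For 6 some preliminary collapses are needed before its link is a cone with apex 5.\<close>
  show "collapses_to [([7], 6), ([2,5,6], 1), ([2,6], 3), ([1,3,6], 4), ([1,6], 0), ([6],
      5)] ?B (circulant_facets 6)"
    by code_simp
  \<comment> \<open>The two spheres are the triangle 0, 1, 2 capped by 6 and the triangle 2, 4, 5
    capped by 7; the vertex 2 is their common point.\<close>
  show "collapses_to [([1,4,5], 0), ([1,2,4], 3), ([1,4], 6), ([1,3], 2), ([0,4], 5), ([0,3], 6),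
      ([3], 4), ([0,5], 1), ([4,6], 7), ([5,6], 2), ([1,5], 2), ([6,7],
      2)] ?B (concat (map boundary_facets [[0,1,2,6], [2,4,5,7]]))"
    by code_simp
qed

lemma circulant_facets_7:
  "geometric_realization (complex_of (circulant_facets 7)) homotopy_equivalent_space
   geometric_realization (complex_of (concat (map boundary_facets [[7,0,2]]) :: nat list list))"
proof (rule common_expansion)
  let ?B = "[[0,1,3,4], [0,1,4,5,7], [0,2,3,6], [0,3,4,6], [1,2,4,5,7], [1,2,5,6,7],
      [2,3,5,6,7]] :: nat list list"
  \<comment> \<open>The cone point 7 lies over the closed star of 5, that is, over the four
    tetrahedra containing 5. Either of 5 and 7 can therefore be deleted, and in the second chain 7
    takes the place of 5.\<close>
  show "collapses_to [([7], 5)] ?B (circulant_facets 7)"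
    by code_simp
  show "collapses_to [([5], 7), ([4,6], 0), ([4], 1), ([1,3], 0), ([6], 2), ([3], 2), ([1],
      7)] ?B (concat (map boundary_facets [[7,0,2]]))"
    by code_simp
qed

lemma circulant_facets_9:
  "geometric_realization (complex_of (circulant_facets 9)) homotopy_equivalent_space
   geometric_realization (complex_of (concat (map boundary_facets [[9,0,6]]) :: nat list list))"
proof (rule common_expansion)
  let ?B = "[[0,1,4,5], [0,1,5,6], [0,3,4,8,9], [0,4,5,8], [1,2,5,6], [1,2,6,7], [2,3,6,7,9],
      [2,3,7,8,9], [3,4,7,8,9]] :: nat list list"
  \<comment> \<open>Here 9 is the cone point over the closed star of 3 and takes the place of 3 in
    the second chain.\<close>
  show "collapses_to [([9], 3)] ?B (circulant_facets 9)"
    by code_simp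
  show "collapses_to [([3], 9), ([2,5], 1), ([2], 7), ([5], 0), ([8], 9), ([1,4], 0), ([1], 6),
      ([7], 9), ([4], 0)] ?B (concat (map boundary_facets [[9,0,6]]))"
    by code_simp
qed

lemma circulant_facets_10:
  "geometric_realization (complex_of (circulant_facets 10)) homotopy_equivalent_space
   geometric_realization (complex_of (concat (map boundary_facets [[10,0,5,1], [11,1,6,2],
       [12,2,7,3], [13,3,8,4], [14,4,9,5]]) :: nat list list))"
proof (rule common_expansion)
  let ?B = "[[0,1,4,5], [0,1,6,7], [0,1,6,10], [0,3,4,9], [0,4,5,14], [0,4,9,14], [0,5,6,9],
      [0,5,6,10], [0,5,9,14], [1,2,5,6], [1,2,7,8], [1,2,7,11], [1,5,6,10], [1,6,7,11], [2,3,6,7],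
      [2,3,8,9], [2,3,8,12], [2,6,7,11], [2,7,8,12], [3,4,7,8], [3,4,9,13], [3,7,8,12], [3,8,9,13],
      [4,5,8,9], [4,8,9,13]] :: nat list list"
  \<comment> \<open>The cone point \<open>10 + i\<close> lies over a disc of three triangles with
    boundary \<open>i\<close>, \<open>i + 1\<close>, \<open>i + 5\<close>, centred at 6, 7, 8, 9, 0
    for \<open>i = 0, ..., 4\<close>; the centre is the apex of its link. Together with the triangle
    on the same boundary the cone over that boundary forms the \<open>i\<close>-th sphere.\<close>
  show "collapses_to [([14], 0), ([13], 9), ([10], 6), ([12], 8), ([11], 7)] ?B (circulant_facets 10)"
    by code_simp
  show "collapses_to [([0,3], 9), ([2,9], 8), ([3,9], 13), ([5,8], 9), ([3,6], 2), ([1,4], 0),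
      ([0,4], 14), ([0,9], 5), ([8,9], 4), ([1,8], 2), ([2,8], 12), ([7,8], 3), ([2,5], 1), ([0,7],
      1), ([6,7], 11), ([0,6], 10), ([1,7], 2), ([6,10], 1), ([0,14], 5), ([4,7], 3), ([7,11], 2),
      ([9,13], 4), ([8,12], 3), ([6,9], 5), ([5,6], 1)] ?B (concat (map boundary_facets [[10,0,5,1],
      [11,1,6,2], [12,2,7,3], [13,3,8,4], [14,4,9,5]]))"
    by code_simp
qed

section \<open>The torus\<close>

text \<open>Each quotient map factors through the other by the universal property. The torus and the
  wedges are identified in this way, without an explicit inverse.\<close>

lemma homeomorphic_space_same_fibres:
  assumes p: "quotient_map X A p" and q: "quotient_map X B q"
    and fib: "\<And>x y. x \<in> topspace X \<Longrightarrow> y \<in> topspace X \<Longrightarrow> p x = p y \<longleftrightarrow> q x = q y"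
  shows "A homeomorphic_space B"
proof -
  obtain f where f: "continuous_map A B f" "\<And>x. x \<in> topspace X \<Longrightarrow> f (p x) = q x"
    using quotient_map_lift_exists[OF p quotient_imp_continuous_map[OF q]] fib by metis
  obtain g where g: "continuous_map B A g" "\<And>x. x \<in> topspace X \<Longrightarrow> g (q x) = p x"
    using quotient_map_lift_exists[OF q quotient_imp_continuous_map[OF p]] fib by metis
  have "g (f a) = a" if "a \<in> topspace A" for a
    using that f(2) g(2) quotient_imp_surjective_map[OF p] by (metis imageE)
  moreover have "f (g b) = b" if "b \<in> topspace B" for b
    using that f(2) g(2) quotient_imp_surjective_map[OF q] by (metis imageE)
  ultimately have "homeomorphic_maps A B f g" using f g by (simp add: homeomorphic_maps_def)
  then show ?thesis by (auto simp: homeomorphic_space_def)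
qed

lemma Hausdorff_geometric_realization: "Hausdorff_space (geometric_realization K)"
  unfolding geometric_realization_def
  by (intro Hausdorff_space_subtopology) (simp add: Hausdorff_space_product_topology)

section \<open>The circle and its universal covering\<close>

definition circle_point :: "real \<Rightarrow> nat \<Rightarrow> real" where
  "circle_point \<theta> = (\<lambda>k. if k = 0 then cos (2 * pi * \<theta>) else if k = 1 then sin (2 * pi * \<theta>) else 0)"

lemma topspace_nsphere_1: "x \<in> topspace (nsphere 1) \<longleftrightarrow> x 0 ^ 2 + x 1 ^ 2 = 1 \<and> (\<forall>i>1. x i = 0)"
  by (simp add: nsphere)

lemma circle_point_in: "circle_point \<theta> \<in> topspace (nsphere 1)"
  unfolding topspace_nsphere_1 by (simp add: circle_point_def)

lemma circle_point_surj:
  assumes "x \<in> topspace (nsphere 1)"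
  obtains \<theta> where "x = circle_point \<theta>"
proof -
  obtain t where t: "x 0 = cos t" "x 1 = sin t"
    using assms unfolding topspace_nsphere_1 by (metis sincos_total_2pi)
  then have "x = circle_point (t / (2 * pi))"
    using assms unfolding topspace_nsphere_1 by (auto simp: circle_point_def fun_eq_iff)
  then show ?thesis using that by blast
qed

text \<open>Angles are measured in full turns, so the fibres are the translates by integers.\<close>

lemma circle_point_eq_iff: "circle_point a = circle_point b \<longleftrightarrow> (\<exists>n::int. a = b + of_int n)"
proof -
  have "circle_point a = circle_point b \<longleftrightarrow>
      sin (2 * pi * a) = sin (2 * pi * b) \<and> cos (2 * pi * a) = cos (2 * pi * b)"
    by (auto simp: circle_point_def fun_eq_iff)
  also have "\<dots> \<longleftrightarrow> (\<exists>n::int. 2 * pi * a = 2 * pi * b + 2 * pi * of_int n)"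
    by (rule sin_cos_eq_iff)
  also have "\<dots> \<longleftrightarrow> (\<exists>n::int. a = b + of_int n)"
    by (simp flip: distrib_left)
  finally show ?thesis .
qed

lemma continuous_map_circle_point:
  assumes "continuous_map X euclideanreal f"
  shows "continuous_map X (nsphere 1) (\<lambda>x. circle_point (f x))"
proof -
  have "continuous_map X (powertop_real UNIV) (\<lambda>x. circle_point (f x))"
  proof (unfold continuous_map_componentwise_UNIV, intro allI)
    fix k
    have c: "continuous_map euclideanreal euclideanreal (\<lambda>\<theta>. circle_point \<theta> k)"
      unfolding circle_point_def
      by (cases "k = 0"; cases "k = 1") (auto intro!: continuous_intros)
    show "continuous_map X euclideanreal (\<lambda>x. circle_point (f x) k)"
      using continuous_map_compose[OF assms c] by (simp add: o_def)
  qed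
  then show ?thesis
    using circle_point_in unfolding nsphere
    by (auto simp: continuous_map_in_subtopology topspace_subtopology)
qed

section \<open>Labels of vertices modulo \<open>m\<close>\<close>

lemma doubleton_subset_image:
  assumes "{a, b} \<subseteq> f ` C"
  obtains p q where "p \<in> C" "q \<in> C" "f p = a" "f q = b"
  using assms by (metis imageE insert_subset)

text \<open>Adding one congruence to the reverse of the other eliminates the base points
  \<open>z\<close> and \<open>x\<close>. Both remaining sums are at most 10, so
  \<open>11 <= m\<close> turns their congruence into an equality.\<close>

lemma label_diff:
  fixes z x p q r t m :: nat
  assumes "11 \<le> m" "p \<le> 5" "q \<le> 5" "r \<le> 5" "t \<le> 5"
    and "(z + p) mod m = (x + r) mod m" "(z + q) mod m = (x + t) mod m"
  shows "p + t = q + r"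
proof -
  have 1: "[z + p = x + r] (mod m)" "[x + t = z + q] (mod m)" using assms by (auto simp: cong_def)
  have "[(z + p) + (x + t) = (x + r) + (z + q)] (mod m)" by (rule cong_add[OF 1])
  then have "[(z + x) + (p + t) = (z + x) + (q + r)] (mod m)" by (simp add: algebra_simps)
  then have "[p + t = q + r] (mod m)" by (simp only: cong_add_lcancel_nat)
  then show ?thesis using assms by (intro cong_less_modulus_unique_nat[of "p + t" "q + r" m]) auto
qed

lemma label_inj:
  fixes z p q m :: nat
  assumes "11 \<le> m" "p \<le> 5" "q \<le> 5" "(z + p) mod m = (z + q) mod m"
  shows "p = q"
  using label_diff[of m p q q q z z] assms by auto

section \<open>The collapse to a triangulated surface\<close>

definition torus_complex :: "nat \<Rightarrow> nat set set" where
  "torus_complex m = {\<rho> \<in> complex_of (circulant_facets m).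
     \<forall>x\<in>{..<m}. \<not> {(x + 1) mod m, (x + 4) mod m} \<subseteq> \<rho>}"

lemma complex_of_circulant_facets_iff:
  assumes "0 < m"
  shows "\<rho> \<in> complex_of (circulant_facets m) \<longleftrightarrow>
     \<rho> \<noteq> {} \<and> (\<exists>x<m. \<rho> \<subseteq> (\<lambda>c. (x + c) mod m) ` {0, 1, 4, 5})"
proof -
  have "\<rho> \<in> complex_of (circulant_facets m) \<longleftrightarrow>
      \<rho> \<noteq> {} \<and> (\<exists>x\<in>{0..<m}. \<rho> \<subseteq> set [x, (x + 1) mod m, (x + 4) mod m, (x + 5) mod m])"
    by (simp add: complex_of_def circulant_facets_def)
  also have "\<dots> \<longleftrightarrow> \<rho> \<noteq> {} \<and> (\<exists>x\<in>{0..<m}. \<rho> \<subseteq> (\<lambda>c. (x + c) mod m) ` {0, 1, 4, 5})"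
    by (rule conj_cong[OF refl], rule bex_cong[OF refl]) simp
  also have "(\<exists>x\<in>{0..<m}. P x) \<longleftrightarrow> (\<exists>x<m. P x)" for P by auto
  finally show ?thesis .
qed

text \<open>Among the labels 0, 1, 4, 5 only the pair 1, 4 has difference 3. Hence an edge of this
  kind determines its tetrahedron, and the corner \<open>x\<close> of that tetrahedron serves as
  apex.\<close>

lemma collapse_to_torus_complex:
  assumes m: "11 \<le> m"
  shows "geometric_realization (complex_of (circulant_facets m)) homotopy_equivalent_space
         geometric_realization (torus_complex m)"
  unfolding torus_complex_def
proof (rule disjoint_collapses[where \<sigma> = "\<lambda>x. {(x + 1) mod m, (x + 4) mod m}" and v = "\<lambda>x. x", OF finite_complex_of down_closed_complex_of])
  have m0: "0 < m" using m by simp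
  fix x assume x: "x \<in> {..<m}"
  show "finite {(x + 1) mod m, (x + 4) mod m} \<and> {(x + 1) mod m, (x + 4) mod m} \<noteq> {} \<and>
    x \<notin> {(x + 1) mod m, (x + 4) mod m}"
    using x m label_inj[of m 0 1 x] label_inj[of m 0 4 x] by auto
  fix \<rho> assume \<rho>: "\<rho> \<in> complex_of (circulant_facets m)" "{(x + 1) mod m, (x + 4) mod m} \<subseteq> \<rho>"
  have edge: "z = y \<and> z < m" 
    if e: "{(y + 1) mod m, (y + 4) mod m} \<subseteq> (\<lambda>c. (z + c) mod m) ` {0, 1, 4, 5}" "y < m" "z < m" for y z
  proof -
    obtain p q where pq: "p \<in> {0, 1, 4, 5}" "q \<in> {0, 1, 4, 5}"
      "(z + p) mod m = (y + 1) mod m" "(z + q) mod m = (y + 4) mod m"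
      using e(1) by (rule doubleton_subset_image)
    then have "p + 4 = q + 1" using m by (intro label_diff[of m p q 1 4 z y]) auto
    then have "p = 1" using pq(1,2) by auto
    then have "[z + 1 = y + 1] (mod m)" using pq(3) by (simp add: cong_def)
    then have "[z = y] (mod m)" by (simp only: cong_add_rcancel_nat)
    then show ?thesis using e by (simp add: cong_less_modulus_unique_nat)
  qed
  obtain z where z: "z < m" "\<rho> \<subseteq> (\<lambda>c. (z + c) mod m) ` {0, 1, 4, 5}"
    using \<rho>(1) m by (auto simp: complex_of_circulant_facets_iff)
  then have "z = x" using edge[of x z] \<rho>(2) x by auto
  have sub: "insert x \<rho> \<subseteq> (\<lambda>c. (x + c) mod m) ` {0, 1, 4, 5}"
    using z x unfolding \<open>z = x\<close> by auto
  then have "insert x \<rho> \<in> complex_of (circulant_facets m)"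
    using m x unfolding complex_of_circulant_facets_iff[OF m0] by blast
  moreover have "\<not> {(y + 1) mod m, (y + 4) mod m} \<subseteq> insert x \<rho>" if "y \<in> {..<m}" "y \<noteq> x" for y
  proof
    assume "{(y + 1) mod m, (y + 4) mod m} \<subseteq> insert x \<rho>"
    then have "{(y + 1) mod m, (y + 4) mod m} \<subseteq> (\<lambda>c. (x + c) mod m) ` {0, 1, 4, 5}"
      using sub by (rule order_trans)
    then have "x = y" using edge[of y x] that x by auto
    then show False using that by simp
  qed
  ultimately show "insert x \<rho> \<in> complex_of (circulant_facets m) \<and>
     (\<forall>j\<in>{..<m}. j \<noteq> x \<longrightarrow> \<not> {(j + 1) mod m, (j + 4) mod m} \<subseteq> insert x \<rho>)" by blast
qed simp

text \<open>Without the edge of the labels 1, 4 a tetrahedron retains the two triangles on the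
  opposite edge 0, 5, which is the diagonal of the square. Conversely, no two labels of either
  triangle differ by 3.\<close>

lemma torus_complex_iff:
  assumes m: "11 \<le> m"
  shows "\<rho> \<in> torus_complex m \<longleftrightarrow> \<rho> \<noteq> {} \<and>
    (\<exists>x<m. \<rho> \<subseteq> (\<lambda>c. (x + c) mod m) ` {0, 1, 5} \<or> \<rho> \<subseteq> (\<lambda>c. (x + c) mod m) ` {0, 4, 5})"
    (is "_ \<longleftrightarrow> ?R")
proof
  assume "\<rho> \<in> torus_complex m"
  then obtain x where x: "\<rho> \<noteq> {}" "x < m" "\<rho> \<subseteq> (\<lambda>c. (x + c) mod m) ` {0, 1, 4, 5}"
    "\<not> {(x + 1) mod m, (x + 4) mod m} \<subseteq> \<rho>"
    using m by (auto simp: torus_complex_def complex_of_circulant_facets_iff)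
  then consider "(x + 1) mod m \<notin> \<rho>" | "(x + 4) mod m \<notin> \<rho>" by auto
  then show ?R
  proof cases
    case 1
    then have "\<rho> \<subseteq> (\<lambda>c. (x + c) mod m) ` {0, 4, 5}" using x(3) by auto
    then show ?thesis using x by blast
  next
    case 2
    then have "\<rho> \<subseteq> (\<lambda>c. (x + c) mod m) ` {0, 1, 5}" using x(3) by auto
    then show ?thesis using x by blast
  qed
next
  assume ?R
  then obtain x C where x: "\<rho> \<noteq> {}" "x < m" and C: "\<rho> \<subseteq> (\<lambda>c. (x + c) mod m) ` C" "C = {0, 1, 5} \<or> C = {0, 4, 5}"
    by blast
  have "\<not> {(y + 1) mod m, (y + 4) mod m} \<subseteq> \<rho>" for y
  proof
    assume "{(y + 1) mod m, (y + 4) mod m} \<subseteq> \<rho>"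
    then have "{(y + 1) mod m, (y + 4) mod m} \<subseteq> (\<lambda>c. (x + c) mod m) ` C" using C(1) by (rule order_trans)
    then obtain p q where pq: "p \<in> C" "q \<in> C"
      "(x + p) mod m = (y + 1) mod m" "(x + q) mod m = (y + 4) mod m"
      by (rule doubleton_subset_image)
    then have "p + 4 = q + 1" using m C(2) by (intro label_diff[of m p q 1 4 x y]) auto
    then show False using pq(1,2) C(2) by auto
  qed
  moreover have "\<rho> \<subseteq> (\<lambda>c. (x + c) mod m) ` {0, 1, 4, 5}" using C by auto
  ultimately show "\<rho> \<in> torus_complex m"
    using x m by (auto simp: torus_complex_def complex_of_circulant_facets_iff)
qed

text \<open>The square \<open>[i, i + 1] \<times> [0, 1]\<close> of a strip, cut along its diagonal, with corners
  \<open>i\<close>, \<open>i + 1\<close> on the bottom and \<open>i + 4\<close>, \<open>i + 5\<close> on the top.\<close>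

definition corner_weight :: "nat \<Rightarrow> real \<times> real \<Rightarrow> real" where
  "corner_weight c = (\<lambda>(r, v). if c = 0 then 1 - max r v else if c = 1 then max (r - v) 0
     else if c = 4 then max (v - r) 0 else if c = 5 then min r v else 0)"

text \<open>Summing over the corners, instead of distinguishing cases on \<open>k\<close>, keeps the
  value meaningful when labels coincide; the gluing rules then hold for every
  \<open>m\<close>.\<close>

definition cell :: "nat \<Rightarrow> nat \<Rightarrow> real \<times> real \<Rightarrow> nat \<Rightarrow> real" where
  "cell m i p = (\<lambda>k. \<Sum>c\<in>{0, 1, 4, 5}. of_bool (k = (i + c) mod m) * corner_weight c p)"

text \<open>The strip \<open>[0, m] x [0, 1]\<close> is a fundamental domain of the lattice
  \<open>i + 4j = 0 (mod m)\<close>, which is spanned by \<open>(m, 0)\<close> and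
  \<open>(4, -1)\<close>.\<close>

definition strip_map :: "nat \<Rightarrow> real \<times> real \<Rightarrow> nat \<Rightarrow> real" where
  "strip_map m = (\<lambda>(u, v). cell m (nat \<lfloor>u\<rfloor>) (frac u, v))"

text \<open>The linear map \<open>(u, v) -> ((u + 4v) / m, v)\<close> carries \<open>(m, 0)\<close>
  to \<open>(1, 0)\<close> and \<open>(4, -1)\<close> to \<open>(0, -1)\<close>, hence the lattice
  onto the integer lattice.\<close>

definition torus_param :: "nat \<Rightarrow> real \<times> real \<Rightarrow> (nat \<Rightarrow> real) \<times> (nat \<Rightarrow> real)" where
  "torus_param m = (\<lambda>(u, v). (circle_point ((u + 4 * v) / m), circle_point v))"

lemma corner_weight_nonneg: "p \<in> {0..1} \<times> {0..1} \<Longrightarrow> 0 \<le> corner_weight c p"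
  by (auto simp: corner_weight_def)

lemma corner_weight_sum:
  "p \<in> {0..1} \<times> {0..1} \<Longrightarrow> (\<Sum>c\<in>{0, 1, 4, 5}. corner_weight c p) = 1"
  by (auto simp: corner_weight_def)

lemma cell_corner:
  assumes "11 \<le> m" "c \<in> {0, 1, 4, 5}"
  shows "cell m i p ((i + c) mod m) = corner_weight c p"
proof -
  have "cell m i p ((i + c) mod m) = (\<Sum>c'\<in>{0, 1, 4, 5}. of_bool (c = c') * corner_weight c' p)"
    unfolding cell_def
  proof (rule sum.cong[OF refl])
    fix c' :: nat assume "c' \<in> {0, 1, 4, 5}"
    then have "(i + c) mod m = (i + c') mod m \<longleftrightarrow> c = c'"
      using label_inj[of m c c' i] assms by auto
    then show "of_bool ((i + c) mod m = (i + c') mod m) * corner_weight c' p = of_bool (c = c') * corner_weight c' p"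
      by simp
  qed
  also have "\<dots> = corner_weight c p" using assms by auto
  finally show ?thesis .
qed

lemma Union_torus_complex: "11 \<le> m \<Longrightarrow> \<Union>(torus_complex m) \<subseteq> {..<m}"
proof
  fix k assume m: "11 \<le> m" and "k \<in> \<Union>(torus_complex m)"
  then obtain \<rho> where "k \<in> \<rho>" "\<rho> \<in> complex_of (circulant_facets m)" by (auto simp: torus_complex_def)
  moreover have "0 < m" using m by simp
  ultimately obtain x where "k \<in> (\<lambda>c. (x + c) mod m) ` {0, 1, 4, 5}"
    using complex_of_circulant_facets_iff[of m \<rho>] by blast
  then show "k \<in> {..<m}" using \<open>0 < m\<close> by auto
qed

lemma cell_expand:
  "cell m i p k = of_bool (k = i mod m) * corner_weight 0 p + of_bool (k = (i + 1) mod m) * corner_weight 1 p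
    + of_bool (k = (i + 4) mod m) * corner_weight 4 p + of_bool (k = (i + 5) mod m) * corner_weight 5 p"
  unfolding cell_def by (simp del: sum_of_bool_mult_eq)

lemma cell_off: "k \<notin> (\<lambda>c. (i + c) mod m) ` {0, 1, 4, 5} \<Longrightarrow> cell m i p k = 0"
  unfolding cell_def by (intro sum.neutral) auto

lemma cell_in_torus_complex:
  assumes m: "11 \<le> m" and p: "p \<in> {0..1} \<times> {0..1}"
  shows "cell m i p \<in> realization_points (torus_complex m)"
proof -
  have V: "finite {..<m}" "\<Union>(torus_complex m) \<subseteq> {..<m}"
    using Union_torus_complex[OF m] by simp_all
  note iff = realization_points_iff[OF V]
  have nonneg: "0 \<le> cell m i p k" for k
    unfolding cell_def using p by (intro sum_nonneg mult_nonneg_nonneg corner_weight_nonneg) auto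
  have off: "cell m i p k = 0" if "k \<notin> {..<m}" for k
    using m that by (intro cell_off) auto
  have "sum (cell m i p) {..<m} = (\<Sum>c\<in>{0, 1, 4, 5}. \<Sum>k<m. of_bool (k = (i + c) mod m) * corner_weight c p)"
    unfolding cell_def by (rule sum.swap)
  also have "\<dots> = (\<Sum>c\<in>{0, 1, 4, 5}. corner_weight c p)"
    using m by (intro sum.cong refl) (simp add: of_bool_def if_distrib[of "\<lambda>x. x * _"] cong: if_cong)
  finally have sum1: "sum (cell m i p) {..<m} = 1" using corner_weight_sum[OF p] by simp
  then have "supp (cell m i p) \<noteq> {}"
    by (metis (mono_tags, lifting) Collect_empty_eq sum.neutral zero_neq_one)
  moreover have "supp (cell m i p) \<subseteq> (\<lambda>c. (i mod m + c) mod m) ` {0, 1, 5} \<or>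
      supp (cell m i p) \<subseteq> (\<lambda>c. (i mod m + c) mod m) ` {0, 4, 5}"
  proof -
    have sub: "supp (cell m i p) \<subseteq> (\<lambda>c. (i + c) mod m) ` {c \<in> {0, 1, 4, 5}. corner_weight c p \<noteq> 0}"
    proof
      fix k assume k: "k \<in> supp (cell m i p)"
      then obtain c where c: "c \<in> {0, 1, 4, 5}" "k = (i + c) mod m"
        using cell_off[of k i m p] by blast
      then show "k \<in> (\<lambda>c. (i + c) mod m) ` {c \<in> {0, 1, 4, 5}. corner_weight c p \<noteq> 0}"
        using k cell_corner[OF m c(1), of i p] by auto
    qed
    \<comment> \<open>The two weights are the positive parts of \<open>r - v\<close> and
      \<open>v - r\<close>: a point lies on one side of the diagonal.\<close>
    have "corner_weight 1 p = 0 \<or> corner_weight 4 p = 0"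
      by (cases p) (auto simp: corner_weight_def)
    then have "{c \<in> {0, 1, 4, 5}. corner_weight c p \<noteq> 0} \<subseteq> {0, 4, 5} \<or>
        {c \<in> {0, 1, 4, 5}. corner_weight c p \<noteq> 0} \<subseteq> {0, 1, 5}" by auto
    then show ?thesis
      using sub unfolding mod_add_left_eq by (meson image_mono order_trans)
  qed
  ultimately have "supp (cell m i p) \<in> torus_complex m"
    unfolding torus_complex_iff[OF m] using m by (meson mod_less_divisor less_le_trans zero_less_numeral)
  then show ?thesis using nonneg off sum1 by (simp add: iff)
qed

lemma cell_mod: "cell m (i mod m) p = cell m i p"
  by (simp add: cell_def mod_add_left_eq)

text \<open>The right edge of square \<open>i\<close> has the corners \<open>i + 1\<close> and
  \<open>i + 5\<close>, which are the corners 0 and 4 of square \<open>i + 1\<close>.\<close>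

lemma cell_glue: "0 \<le> v \<Longrightarrow> v \<le> 1 \<Longrightarrow> cell m (Suc i) (0, v) = cell m i (1, v)"
  by (rule ext) (simp add: cell_expand corner_weight_def add.commute[of i])

text \<open>The top edge of square \<open>i\<close> has the corners \<open>i + 4\<close> and
  \<open>i + 5\<close>, which are the corners 0 and 1 of square \<open>i + 4\<close>. This is the
  lattice vector \<open>(4, -1)\<close>.\<close>

lemma cell_top: "0 \<le> r \<Longrightarrow> r \<le> 1 \<Longrightarrow> cell m (i + 4) (r, 0) = cell m i (r, 1)"
  by (rule ext) (simp add: cell_expand corner_weight_def add.commute[of i])

lemma strip_map_cell:
  assumes "real i \<le> u" "u \<le> real i + 1" "0 \<le> v" "v \<le> 1"
  shows "strip_map m (u, v) = cell m i (u - real i, v)"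
proof (cases "u = real i + 1")
  \<comment> \<open>On the right edge the floor has already jumped to \<open>i + 1\<close>, and the
    neighbouring square must supply the value.\<close>
  case True
  then have fl: "\<lfloor>u\<rfloor> = int (Suc i)" by (simp add: floor_eq_iff)
  then have "frac u = 0" using True by (simp add: frac_def)
  then have "strip_map m (u, v) = cell m (Suc i) (0, v)"
    unfolding strip_map_def split_conv fl nat_int by (simp only:)
  then show ?thesis using True cell_glue assms by simp
next
  case False
  then have "\<lfloor>u\<rfloor> = int i" using assms by (simp add: floor_eq_iff)
  then show ?thesis by (simp add: strip_map_def frac_def)
qed

lemma continuous_on_cell: "continuous_on S (cell m i)"
proof -
  have "continuous_on S (corner_weight c)" for c
  proof -
    have "corner_weight c = (\<lambda>p. if c = 0 then 1 - max (fst p) (snd p) else if c = 1 then max (fst p - snd p) 0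
     else if c = 4 then max (snd p - fst p) 0 else if c = 5 then min (fst p) (snd p) else 0)"
      by (auto simp: corner_weight_def fun_eq_iff)
    then show ?thesis
      by (cases "c = 0"; cases "c = 1"; cases "c = 4"; cases "c = 5") (auto intro!: continuous_intros)
  qed
  then show ?thesis
    unfolding cell_def
    by (intro continuous_on_coordinatewise_then_product continuous_on_sum continuous_on_mult continuous_on_const)
qed

text \<open>Pasting over the finitely many closed unit squares, on each of which the floor has been
  replaced by a constant.\<close>

lemma continuous_on_strip_map: "continuous_on ({0..real m} \<times> {0..1}) (strip_map m)"
proof (cases "m = 0")
  \<comment> \<open>For \<open>m = 0\<close> the strip is a segment, which no union of zero squares
    covers.\<close>
  case True
  have "continuous_on ({0..0} \<times> {0..1}) (cell 0 0)" by (rule continuous_on_cell)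
  moreover have "strip_map 0 p = cell 0 0 p" if "p \<in> {0..0} \<times> {0..1}" for p
    using that by (auto simp: strip_map_def)
  ultimately show ?thesis unfolding True of_nat_0 by (metis (no_types, lifting) continuous_on_cong)
next
  case False
  have "{0..real m} \<times> {0..1} = (\<Union>i\<in>{..<m}. {real i..real i + 1} \<times> {0..1::real})"
  proof (intro equalityI subsetI)
    fix p assume "p \<in> {0..real m} \<times> {0..1::real}"
    then obtain u v where p: "p = (u, v)" "0 \<le> u" "u \<le> real m" "0 \<le> v" "v \<le> 1" by auto
    show "p \<in> (\<Union>i\<in>{..<m}. {real i..real i + 1} \<times> {0..1})"
    proof (cases "u = real m")
      case True
      then show ?thesis using False p by (intro UN_I[of "m - 1"]) (auto simp: of_nat_diff)
    next
      case False
      then have "nat \<lfloor>u\<rfloor> < m" using p by linarith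
      moreover have "real (nat \<lfloor>u\<rfloor>) \<le> u" "u \<le> real (nat \<lfloor>u\<rfloor>) + 1" using p by linarith+
      ultimately show ?thesis using p by (intro UN_I[of "nat \<lfloor>u\<rfloor>"]) auto
    qed
  next
    fix p assume "p \<in> (\<Union>i\<in>{..<m}. {real i..real i + 1} \<times> {0..1::real})"
    then obtain i where "i < m" "p \<in> {real i..real i + 1} \<times> {0..1}" by auto
    moreover have "real i + 1 \<le> real m" using \<open>i < m\<close> by linarith
    ultimately show "p \<in> {0..real m} \<times> {0..1}" by auto
  qed
  moreover have "continuous_on (\<Union>i\<in>{..<m}. {real i..real i + 1} \<times> {0..1::real}) (strip_map m)"
  proof (rule continuous_on_closed_Union)
    fix i
    have "continuous_on ({real i..real i + 1} \<times> {0..1}) (\<lambda>p. cell m i (fst p - real i, snd p))"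
      by (rule continuous_on_compose2[OF continuous_on_cell[of UNIV]])
        (auto intro!: continuous_on_Pair continuous_on_diff continuous_on_fst continuous_on_snd continuous_on_id)
    then show "continuous_on ({real i..real i + 1} \<times> {0..1}) (strip_map m)"
      by (rule continuous_on_eq) (auto simp: strip_map_cell)
  qed (auto intro: closed_Times)
  ultimately show ?thesis by simp
qed

lemma strip_map_shift:
  assumes "real m \<le> u"
  shows "strip_map m (u, v) = strip_map m (u - real m, v)"
proof -
  have fl: "\<lfloor>u - real m\<rfloor> = \<lfloor>u\<rfloor> - int m" using floor_diff_of_int[of u "int m"] by simp
  then have "frac (u - real m) = frac u" by (simp add: frac_def)
  moreover have "nat \<lfloor>u\<rfloor> = nat (\<lfloor>u\<rfloor> - int m) + m" using assms by linarith
  then have "cell m (nat \<lfloor>u\<rfloor>) = cell m (nat (\<lfloor>u\<rfloor> - int m))"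
    by (metis cell_mod mod_add_self2 ext)
  ultimately show ?thesis using fl by (simp add: strip_map_def)
qed

lemma strip_map_top:
  assumes "0 \<le> u"
  shows "strip_map m (u, 1) = strip_map m (u + 4, 0)"
proof -
  have "\<lfloor>u + 4\<rfloor> = \<lfloor>u\<rfloor> + 4" "frac (u + 4) = frac u" by (auto simp: frac_def)
  moreover have "nat (\<lfloor>u\<rfloor> + 4) = nat \<lfloor>u\<rfloor> + 4" using assms by (simp add: nat_add_distrib)
  moreover have "0 \<le> frac u" "frac u \<le> 1" by (auto simp: less_imp_le frac_lt_1)
  ultimately show ?thesis by (simp add: strip_map_def cell_top)
qed

lemma torus_param_shift: "0 < m \<Longrightarrow> torus_param m (u, v) = torus_param m (u - real m, v)"
  unfolding torus_param_def by (auto simp: circle_point_eq_iff field_simps intro: exI[of _ 1])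

lemma torus_param_top: "torus_param m (u, 1) = torus_param m (u + 4, 0)"
  unfolding torus_param_def by (simp add: circle_point_eq_iff)

text \<open>A point of the top edge moves to the bottom by adding 4 to \<open>u\<close>; afterwards
  \<open>u\<close> is at most \<open>m + 4 < 2m\<close>, so at most one shift by \<open>m\<close> is
  needed. Neither map notices the moves, which reduces the comparison of fibres to the half-open
  rectangle, where both maps are injective.\<close>

lemma strip_normal_form:
  assumes m: "11 \<le> m" and p: "p \<in> {0..real m} \<times> {0..1}"
  obtains q where "q \<in> {0..<real m} \<times> {0..<1}" "strip_map m q = strip_map m p" "torus_param m q = torus_param m p"
proof -
  obtain u v where uv: "p = (u, v)" "0 \<le> u" "u \<le> real m" "0 \<le> v" "v \<le> 1" using p by auto
  have "\<exists>u' v'. 0 \<le> u' \<and> u' \<le> real m + 4 \<and> 0 \<le> v' \<and> v' < 1 \<and>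
      strip_map m (u', v') = strip_map m p \<and> torus_param m (u', v') = torus_param m p"
  proof (cases "v = 1")
    case True
    then show ?thesis using uv strip_map_top[of u m] torus_param_top[of m u]
      by (intro exI[of _ "u + 4"] exI[of _ 0]) auto
  next
    case False
    then show ?thesis using uv by (intro exI[of _ u] exI[of _ v]) auto
  qed
  then obtain u' v' where u': "0 \<le> u'" "u' \<le> real m + 4" "0 \<le> v'" "v' < 1"
      "strip_map m (u', v') = strip_map m p" "torus_param m (u', v') = torus_param m p" by blast
  show thesis
  proof (cases "u' < real m")
    case True
    then show ?thesis using that[of "(u', v')"] u' by auto
  next
    case False
    then show ?thesis using that[of "(u' - real m, v')"] u' strip_map_shift[of m u' v'] torus_param_shift[of m u' v'] m
      by auto
  qed
qed

lemma torus_param_inj: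
  assumes m: "0 < m" and p: "p \<in> {0..<real m} \<times> {0..<1}" "q \<in> {0..<real m} \<times> {0..<1}"
    and eq: "torus_param m p = torus_param m q"
  shows "p = q"
proof -
  obtain u v u' v' where uv: "p = (u, v)" "0 \<le> u" "u < real m" "0 \<le> v" "v < 1"
     "q = (u', v')" "0 \<le> u'" "u' < real m" "0 \<le> v'" "v' < 1" using p by auto
  obtain k l :: int where k: "v = v' + of_int k" and l: "(u + 4 * v) / m = (u' + 4 * v') / m + of_int l"
    using eq uv by (auto simp: torus_param_def circle_point_eq_iff)
  have "k = 0" using k uv by linarith
  then have "v = v'" using k by simp
  then have ul: "u = u' + m * of_int l" using l m by (simp add: field_simps)
  have "l = 0"
  proof (rule ccontr)
    assume "l \<noteq> 0"
    then have "1 \<le> \<bar>real_of_int l\<bar>" by linarith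
    then have "real m \<le> \<bar>u - u'\<bar>" using ul m by (simp add: abs_mult)
    then show False using uv by linarith
  qed
  then show ?thesis using ul \<open>v = v'\<close> uv by simp
qed

text \<open>Off the right and top edges of a square its corner 0 has positive weight. So the corner
  0 of each of the two squares is a corner of the other square, which forces the squares to
  agree.\<close>

lemma strip_map_inj:
  assumes m: "11 \<le> m" and p: "p \<in> {0..<real m} \<times> {0..<1}" "q \<in> {0..<real m} \<times> {0..<1}"
    and eq: "strip_map m p = strip_map m q"
  shows "p = q"
proof -
  obtain u v u' v' where uv: "p = (u, v)" "0 \<le> u" "u < real m" "0 \<le> v" "v < 1"
     "q = (u', v')" "0 \<le> u'" "u' < real m" "0 \<le> v'" "v' < 1" using p by auto
  define i j where "i = nat \<lfloor>u\<rfloor>" and "j = nat \<lfloor>u'\<rfloor>"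
  have ij: "i < m" "j < m" "u = real i + frac u" "u' = real j + frac u'"
    using uv by (auto simp: i_def j_def frac_def) linarith+
  have ceq: "cell m i (frac u, v) = cell m j (frac u', v')"
    using eq uv by (simp add: strip_map_def i_def j_def)
  have corner: "\<exists>c\<in>{0, 1, 4, 5}. (a + 0) mod m = (b + c) mod m"
    if e: "cell m a (frac x, y) = cell m b z" "y < 1" for a b x y z
  proof -
    have "corner_weight 0 (frac x, y) \<noteq> 0" using e frac_lt_1[of x] by (simp add: corner_weight_def)
    then have "cell m b z ((a + 0) mod m) \<noteq> 0" using cell_corner[OF m, of 0 a "(frac x, y)"] e by simp
    then show ?thesis using cell_off[of "(a + 0) mod m" b m z] by blast
  qed
  obtain c d where cd: "c \<in> {0, 1, 4, 5}" "d \<in> {0, 1, 4, 5}" "(i + 0) mod m = (j + c) mod m" "(j + 0) mod m = (i + d) mod m"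
    using corner[OF ceq] corner[OF ceq[symmetric]] uv by blast
  \<comment> \<open>Here \<open>i\<close> is congruent to \<open>j + c\<close> and \<open>j\<close>
    to \<open>i + d\<close>, so \<open>c + d\<close> vanishes modulo \<open>m\<close> and therefore
    outright.\<close>
  have "0 + 0 = d + c"
    using cd m by (intro label_diff[of m 0 d c 0 i j]) auto
  then have "i = j" using cd(3) ij by simp
  have w: "corner_weight c (frac u, v) = corner_weight c (frac u', v')" if "c \<in> {0, 1, 4, 5}" for c
    using cell_corner[OF m that] ceq \<open>i = j\<close> by metis
  \<comment> \<open>The weights determine the point: the abscissa is the sum of the weights at 1 and
    5, the ordinate that of the weights at 4 and 5.\<close>
  have "frac u = frac u' \<and> v = v'"
    using w[of 0] w[of 1] w[of 4] w[of 5] by (auto simp: corner_weight_def max_def min_def split: if_splits)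
  then show ?thesis using ij \<open>i = j\<close> uv by simp
qed

lemma strip_map_surj:
  assumes m: "11 \<le> m" and x: "x \<in> realization_points (torus_complex m)"
  obtains p where "p \<in> {0..real m} \<times> {0..1}" "strip_map m p = x"
proof -
  have V: "finite {..<m}" "\<Union>(torus_complex m) \<subseteq> {..<m}"
    using Union_torus_complex[OF m] by simp_all
  have x': "\<And>k. 0 \<le> x k" "sum x {..<m} = 1" "supp x \<in> torus_complex m"
    using x realization_points_iff[OF V] by auto
  obtain j where j: "j < m" and sub: "supp x \<subseteq> (\<lambda>c. (j + c) mod m) ` {0, 1, 5} \<or> supp x \<subseteq> (\<lambda>c. (j + c) mod m) ` {0, 4, 5}"
    using x'(3) unfolding torus_complex_iff[OF m] by blast
  define X where "X c = x ((j + c) mod m)" for c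
  have inj: "inj_on (\<lambda>c. (j + c) mod m) {0, 1, 4, 5}"
  proof (rule inj_onI)
    fix c d :: nat assume cd: "c \<in> {0, 1, 4, 5}" "d \<in> {0, 1, 4, 5}" "(j + c) mod m = (j + d) mod m"
    have "c \<le> 5" "d \<le> 5" using cd(1,2) by auto
    then show "c = d" using cd(3) by (rule label_inj[OF m])
  qed
  have sub4: "supp x \<subseteq> (\<lambda>c. (j + c) mod m) ` {0, 1, 4, 5}" using sub by auto
  have zero: "X 1 = 0 \<or> X 4 = 0"
  proof (rule ccontr)
    assume "\<not> ?thesis"
    then have "{(j + 1) mod m, (j + 4) mod m} \<subseteq> supp x" by (auto simp: X_def)
    then show False
      using x'(3) j by (auto simp: torus_complex_def)
  qed
  have "sum x {..<m} = sum x ((\<lambda>c. (j + c) mod m) ` {0, 1, 4, 5})"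
    using sub4 m by (intro sum.mono_neutral_right) auto
  also have "\<dots> = (\<Sum>c\<in>{0, 1, 4, 5}. X c)"
    by (subst sum.reindex[OF inj]) (simp add: X_def)
  finally have sumX: "X 0 + X 1 + X 4 + X 5 = 1" using x' by simp
  have posX: "0 \<le> X c" for c using x' by (simp add: X_def)
  \<comment> \<open>The mass on the two right corners is the abscissa, the mass on the two top
    corners the ordinate.\<close>
  define r v where "r = X 1 + X 5" and "v = X 4 + X 5"
  have rv: "0 \<le> r" "r \<le> 1" "0 \<le> v" "v \<le> 1" using sumX posX[of 0] posX[of 1] posX[of 4] posX[of 5] by (auto simp: r_def v_def)
  have w: "corner_weight c (r, v) = X c" if "c \<in> {0, 1, 4, 5}" for c
    using that zero posX[of 0] posX[of 1] posX[of 4] posX[of 5] sumX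
    by (auto simp: corner_weight_def r_def v_def)
  have "strip_map m (real j + r, v) = cell m j (r, v)"
    using strip_map_cell[of j "real j + r" v m] rv by simp
  also have "\<dots> = x"
  proof
    fix k
    show "cell m j (r, v) k = x k"
    proof (cases "k \<in> (\<lambda>c. (j + c) mod m) ` {0, 1, 4, 5}")
      case True
      then obtain c where c: "k = (j + c) mod m" "c \<in> {0, 1, 4, 5}" by (rule imageE)
      then show ?thesis using cell_corner[OF m c(2)] w[OF c(2)] by (simp add: X_def)
    next
      case False
      then show ?thesis using sub4 cell_off[OF False] by auto
    qed
  qed
  finally have "strip_map m (real j + r, v) = x" .
  moreover have "real j + 1 \<le> real m" using j by linarith
  then have "(real j + r, v) \<in> {0..real m} \<times> {0..1}" using rv by auto
  ultimately show thesis using that by blast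
qed

lemma strip_map_eq_iff_torus_param_eq:
  assumes m: "11 \<le> m" and p: "p \<in> {0..real m} \<times> {0..1}" "q \<in> {0..real m} \<times> {0..1}"
  shows "strip_map m p = strip_map m q \<longleftrightarrow> torus_param m p = torus_param m q"
proof -
  obtain p' where p': "p' \<in> {0..<real m} \<times> {0..<1}" "strip_map m p' = strip_map m p" "torus_param m p' = torus_param m p"
    using strip_normal_form[OF m p(1)] .
  obtain q' where q': "q' \<in> {0..<real m} \<times> {0..<1}" "strip_map m q' = strip_map m q" "torus_param m q' = torus_param m q"
    using strip_normal_form[OF m p(2)] .
  have "strip_map m p' = strip_map m q' \<longleftrightarrow> torus_param m p' = torus_param m q'"
    using strip_map_inj[OF m p'(1) q'(1)] torus_param_inj[OF _ p'(1) q'(1)] m by auto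
  then show ?thesis using p' q' by simp
qed

lemma torus_param_surj:
  assumes m: "0 < m" and y: "y \<in> topspace torus"
  obtains p where "p \<in> {0..real m} \<times> {0..1}" "torus_param m p = y"
proof -
  obtain \<alpha> \<beta> where ab: "fst y = circle_point \<alpha>" "snd y = circle_point \<beta>"
    using y circle_point_surj unfolding torus_def topspace_prod_topology by (metis mem_Times_iff)
  define v where "v = frac \<beta>"
  \<comment> \<open>The solution of \<open>(u + 4v) / m = \<alpha>\<close> modulo integers that lies
    in \<open>[0, m)\<close>.\<close>
  define u where "u = real m * frac (\<alpha> - 4 * v / m)"
  have "circle_point v = circle_point \<beta>"
    unfolding circle_point_eq_iff by (rule exI[of _ "- \<lfloor>\<beta>\<rfloor>"]) (simp add: v_def frac_def)
  moreover have "circle_point ((u + 4 * v) / m) = circle_point \<alpha>"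
    unfolding circle_point_eq_iff
    by (rule exI[of _ "- \<lfloor>\<alpha> - 4 * v / m\<rfloor>"]) (use m in \<open>simp add: u_def frac_def add_divide_distrib\<close>)
  ultimately have "torus_param m (u, v) = y" using ab by (simp add: torus_param_def prod_eq_iff)
  moreover have "(u, v) \<in> {0..real m} \<times> {0..1}"
    using m frac_lt_1[of \<beta>] frac_lt_1[of "\<alpha> - 4 * v / m"]
    by (auto simp: u_def v_def less_imp_le intro: mult_left_le)
  ultimately show thesis using that by blast
qed

text \<open>Both maps go from the compact strip onto a Hausdorff space, hence are quotient maps, and
  they have the same fibres.\<close>

lemma torus_complex_homeomorphic_torus:
  assumes m: "11 \<le> m"
  shows "geometric_realization (torus_complex m) homeomorphic_space torus"
proof -
  let ?D = "{0..real m} \<times> {0..1::real}"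
  have D: "compact_space (top_of_set ?D)" by (simp add: compact_space_subtopology compact_Times)
  have sub: "strip_map m p \<in> realization_points (torus_complex m)" if p: "p \<in> ?D" for p
  proof -
    have "strip_map m p = cell m (nat \<lfloor>fst p\<rfloor>) (frac (fst p), snd p)"
      by (simp add: strip_map_def case_prod_unfold)
    then show ?thesis using cell_in_torus_complex[OF m, of "(frac (fst p), snd p)"] p frac_lt_1[of "fst p"]
      by (auto simp: less_imp_le)
  qed
  have strip: "quotient_map (top_of_set ?D) (geometric_realization (torus_complex m)) (strip_map m)"
  proof (rule continuous_imp_quotient_map[OF _ D Hausdorff_geometric_realization])
    show "continuous_map (top_of_set ?D) (geometric_realization (torus_complex m)) (strip_map m)"
      using sub continuous_on_strip_map by (auto simp: geometric_realization_eq continuous_map_in_subtopology)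
    have "realization_points (torus_complex m) \<subseteq> strip_map m ` ?D"
      using strip_map_surj[OF m] by (metis (no_types, lifting) imageI subsetI)
    then show "strip_map m ` topspace (top_of_set ?D) = topspace (geometric_realization (torus_complex m))"
      using sub by (auto simp: geometric_realization_eq)
  qed
  have c: "continuous_map (top_of_set ?D) euclideanreal (\<lambda>p. (fst p + 4 * snd p) / real m)"
    "continuous_map (top_of_set ?D) euclideanreal (\<lambda>p. snd p)"
    using m by (auto intro!: continuous_intros)
  have tp: "torus_param m = (\<lambda>p. (circle_point ((fst p + 4 * snd p) / real m), circle_point (snd p)))"
    by (auto simp: torus_param_def)
  have cont: "continuous_map (top_of_set ?D) torus (torus_param m)"
    unfolding torus_def tp
    using continuous_map_circle_point[OF c(1)] continuous_map_circle_point[OF c(2)]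
    by (simp add: continuous_map_pairwise o_def)
  have param: "quotient_map (top_of_set ?D) torus (torus_param m)"
  proof (rule continuous_imp_quotient_map[OF cont D])
    have "topspace torus \<subseteq> torus_param m ` ?D"
      using torus_param_surj[of m] m by (metis (no_types, lifting) imageI subsetI less_le_trans zero_less_numeral)
    then show "torus_param m ` topspace (top_of_set ?D) = topspace torus"
      using continuous_map_image_subset_topspace[OF cont] by auto
    show "Hausdorff_space torus"
      unfolding torus_def nsphere
      by (simp add: Hausdorff_space_prod_topology Hausdorff_space_subtopology Hausdorff_space_product_topology)
  qed
  show ?thesis
    using homeomorphic_space_same_fibres[OF strip param] strip_map_eq_iff_torus_param_eq[OF m] by simp
qed

section \<open>Spheres, wedges and garlands\<close>

definition vertex_point :: "'v \<Rightarrow> 'v \<Rightarrow> real" where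
  "vertex_point c = (\<lambda>u. if u = c then 1 else 0)"

lemma boundary_facets_iff:
  "\<rho> \<in> complex_of (boundary_facets vs) \<longleftrightarrow> \<rho> \<noteq> {} \<and> \<rho> \<subset> set vs"
  by (auto simp: complex_of_def boundary_facets_def)

lemma realization_boundary_iff:
  "x \<in> realization_points (complex_of (boundary_facets vs)) \<longleftrightarrow>
     (\<forall>u. 0 \<le> x u) \<and> (\<forall>u. u \<notin> set vs \<longrightarrow> x u = 0) \<and> sum x (set vs) = 1 \<and> (\<exists>u\<in>set vs. x u = 0)"
proof -
  have "finite (set vs)" "\<Union>(complex_of (boundary_facets vs)) \<subseteq> set vs"
    by (auto simp: boundary_facets_iff)
  note iff = realization_points_iff[OF this]
  have "supp x \<noteq> {}" if "sum x (set vs) = 1"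
    using that by (metis (mono_tags, lifting) Collect_empty_eq sum.neutral zero_neq_one)
  then show ?thesis unfolding iff boundary_facets_iff by auto
qed

lemma realization_complex_of_concat:
  "realization_points (complex_of (concat Fss)) = (\<Union>Fs\<in>set Fss. realization_points (complex_of Fs))"
  by (auto simp: realization_points_def complex_of_def)

lemma vertex_point_in_boundary:
  assumes "c \<in> set vs" "set vs \<noteq> {c}"
  shows "vertex_point c \<in> realization_points (complex_of (boundary_facets vs))"
  using assms by (auto simp: realization_boundary_iff vertex_point_def)

text \<open>A common point is supported on the common vertices; there is at most one of them, and it
  must carry the whole mass 1. Single vertices are excluded since their boundary is empty.\<close>

lemma realization_boundary_Int:
  assumes "set vs \<inter> set ws \<subseteq> {c}" "set vs \<noteq> {c}" "set ws \<noteq> {c}"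
  shows "realization_points (complex_of (boundary_facets vs)) \<inter> realization_points (complex_of (boundary_facets ws))
    = vertex_point ` (set vs \<inter> set ws)"
proof (intro equalityI subsetI)
  fix x assume "x \<in> realization_points (complex_of (boundary_facets vs)) \<inter>
    realization_points (complex_of (boundary_facets ws))"
  then have x: "\<And>u. 0 \<le> x u" "sum x (set vs) = 1" "\<And>u. u \<notin> set vs \<inter> set ws \<Longrightarrow> x u = 0"
    by (auto simp: realization_boundary_iff)
  have "sum x (set vs) = sum x (set vs \<inter> set ws)"
    using x(3) by (intro sum.mono_neutral_right) auto
  then have "sum x (set vs \<inter> set ws) = 1" using x by simp
  moreover from this have "set vs \<inter> set ws = {c}"
    using assms(1) by (metis subset_singletonD sum.empty zero_neq_one)
  ultimately have "x = vertex_point c" "c \<in> set vs \<inter> set ws"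
    using x(3) by (auto simp: vertex_point_def fun_eq_iff)
  then show "x \<in> vertex_point ` (set vs \<inter> set ws)" by blast
next
  fix x :: "'a \<Rightarrow> real" assume "x \<in> vertex_point ` (set vs \<inter> set ws)"
  then have x: "x = vertex_point c" "c \<in> set vs" "c \<in> set ws" using assms(1) by auto
  then show "x \<in> realization_points (complex_of (boundary_facets vs)) \<inter>
    realization_points (complex_of (boundary_facets ws))"
    unfolding x(1) using vertex_point_in_boundary[OF x(2) assms(2)] vertex_point_in_boundary[OF x(3) assms(3)]
    by blast
qed

section \<open>Simplex boundaries as spheres\<close>

lemma homeomorphic_map_from_compact:
  fixes f :: "'a::topological_space \<Rightarrow> 'b"
  assumes "compact S" "Hausdorff_space Y" "continuous_map (top_of_set S) Y f" "inj_on f S"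
    "topspace Y \<subseteq> f ` S"
  shows "homeomorphic_map (top_of_set S) Y f"
proof (rule continuous_imp_homeomorphic_map)
  show "f ` topspace (top_of_set S) = topspace Y"
    using assms(5) continuous_map_image_subset_topspace[OF assms(3)] by auto
qed (use assms in \<open>auto simp: compact_space_subtopology\<close>)

lemma sphere_homeomorphic_nsphere:
  "\<exists>f. homeomorphic_map (top_of_set (sphere (0::'a::euclidean_space) 1)) (nsphere (DIM('a) - 1)) f"
proof -
  define d where "d = DIM('a) - 1"
  have D: "DIM('a) = Suc d" by (simp add: d_def)
  obtain \<beta> where \<beta>: "bij_betw \<beta> {..d} (Basis :: 'a set)"
    using finite_same_card_bij[of "{..d}" "Basis :: 'a set"] D by auto
  define f where "f x = (\<lambda>i. if i \<le> d then x \<bullet> \<beta> i else 0)" for x :: 'a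
  have B: "\<beta> i \<in> Basis" if "i \<le> d" for i using \<beta> that by (auto simp: bij_betw_def)
  have norm: "(norm x)\<^sup>2 = (\<Sum>i\<le>d. (f x i)\<^sup>2)" for x
  proof -
    have "(norm x)\<^sup>2 = (\<Sum>b\<in>Basis. (x \<bullet> b)\<^sup>2)"
      unfolding power2_norm_eq_inner by (subst euclidean_inner) (simp add: power2_eq_square)
    also have "\<dots> = (\<Sum>i\<le>d. (x \<bullet> \<beta> i)\<^sup>2)"
      using sum.reindex_bij_betw[OF \<beta>, of "\<lambda>b. (x \<bullet> b)\<^sup>2"] by simp
    finally show ?thesis by (simp add: f_def)
  qed
  have "homeomorphic_map (top_of_set (sphere 0 1)) (nsphere d) f"
  proof (rule homeomorphic_map_from_compact)
    show "Hausdorff_space (nsphere d)"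
      unfolding nsphere by (intro Hausdorff_space_subtopology) (simp add: Hausdorff_space_product_topology)
    have "continuous_on (sphere 0 1) (\<lambda>x. f x i)" for i
      by (cases "i \<le> d") (auto simp: f_def intro!: continuous_intros)
    then have "continuous_on (sphere 0 1) f" by (rule continuous_on_coordinatewise_then_product)
    moreover have "f x \<in> topspace (nsphere d)" if "x \<in> sphere 0 1" for x
      using that norm[of x] by (simp add: nsphere) (simp add: f_def)
    ultimately show "continuous_map (top_of_set (sphere 0 1)) (nsphere d) f"
      unfolding nsphere euclidean_product_topology by (auto simp: continuous_map_in_subtopology)
    show "inj_on f (sphere 0 1)"
    proof (rule inj_onI)
      fix x y assume "f x = f y"
      then have "f x i = f y i" for i by simp
      then have "x \<bullet> \<beta> i = y \<bullet> \<beta> i" if "i \<le> d" for i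
        using that unfolding f_def by metis
      moreover have "\<exists>i\<le>d. b = \<beta> i" if "b \<in> Basis" for b
        using \<beta> that by (auto simp: bij_betw_def)
      ultimately show "x = y" by (metis euclidean_eqI)
    qed
    show "topspace (nsphere d) \<subseteq> f ` sphere 0 1"
    proof
      fix y assume y: "y \<in> topspace (nsphere d)"
      define x where "x = (\<Sum>i\<le>d. y i *\<^sub>R \<beta> i)"
      have inner: "x \<bullet> \<beta> j = y j" if "j \<le> d" for j
      proof -
        have "x \<bullet> \<beta> j = (\<Sum>i\<le>d. y i * (\<beta> i \<bullet> \<beta> j))" by (simp add: x_def inner_sum_left)
        also have "\<dots> = (\<Sum>i\<le>d. if i = j then y i else 0)"
          using B that \<beta> by (intro sum.cong refl) (auto simp: inner_Basis bij_betw_def inj_on_def)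
        finally show ?thesis using that by simp
      qed
      have "f x = y" using y inner by (auto simp: f_def fun_eq_iff nsphere)
      moreover from this have "(norm x)\<^sup>2 = 1" using y norm[of x] by (simp add: nsphere)
      then have "norm x = 1" by (simp add: power2_eq_1_iff) (metis norm_ge_zero not_one_le_zero neg_0_le_iff_le)
      ultimately show "y \<in> f ` sphere 0 1" by auto
    qed
  qed simp
  then show ?thesis by (auto simp: d_def)
qed

text \<open>Barycentric coordinates on the standard simplex: the vertices of \<open>V\<close>
  receive the Cartesian coordinates and \<open>c0\<close>, which stands for the origin, the slack
  \<open>1 - sum\<close>. The frontier is where one of all these coordinates vanishes.\<close>

lemma frontier_simplex_homeomorphic_boundary:
  fixes vs :: "'v list"
  assumes card: "card (set vs) = DIM('a::euclidean_space) + 1"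
  shows "top_of_set (frontier (convex hull insert 0 (Basis :: 'a set))) homeomorphic_space
         geometric_realization (complex_of (boundary_facets vs))"
proof -
  let ?S = "convex hull insert 0 (Basis :: 'a set)"
  obtain c0 where c0: "c0 \<in> set vs" using card by fastforce
  define V where "V = set vs - {c0}"
  have V: "finite V" "card V = DIM('a)" "c0 \<notin> V" "set vs = insert c0 V" using c0 card by (auto simp: V_def)
  obtain \<beta> where \<beta>: "bij_betw \<beta> V (Basis :: 'a set)"
    using finite_same_card_bij[of V "Basis :: 'a set"] V by auto
  have B: "\<beta> u \<in> Basis" if "u \<in> V" for u using \<beta> that by (auto simp: bij_betw_def)
  have surj: "\<exists>u\<in>V. b = \<beta> u" if "b \<in> Basis" for b using \<beta> that by (auto simp: bij_betw_def)
  define f where "f x = (\<lambda>u. if u = c0 then 1 - (\<Sum>b\<in>Basis. x \<bullet> b) else if u \<in> V then x \<bullet> \<beta> u else 0)" for x :: 'a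
  have comp: "compact ?S" by (simp add: finite_imp_compact_convex_hull)
  have fr: "frontier ?S = {x. (\<forall>b\<in>Basis. 0 \<le> x \<bullet> b) \<and> (\<Sum>b\<in>Basis. x \<bullet> b) \<le> 1 \<and>
      ((\<exists>b\<in>Basis. x \<bullet> b = 0) \<or> (\<Sum>b\<in>Basis. x \<bullet> b) = 1)}"
    unfolding frontier_def closure_closed[OF compact_imp_closed[OF comp]] interior_std_simplex
    unfolding std_simplex by (force simp: order.order_iff_strict)
  have sumB: "(\<Sum>b\<in>Basis. x \<bullet> b) = (\<Sum>u\<in>V. x \<bullet> \<beta> u)" for x :: 'a
    using sum.reindex_bij_betw[OF \<beta>, of "\<lambda>b. x \<bullet> b"] by simp
  have sumf: "sum (f x) (set vs) = 1" for x
  proof -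
    have "sum (f x) (set vs) = f x c0 + (\<Sum>u\<in>V. x \<bullet> \<beta> u)"
      using V(1,3) unfolding V(4) by (subst sum.insert) (auto simp: f_def intro!: sum.cong)
    then show ?thesis by (simp add: f_def sumB)
  qed
  have "homeomorphic_map (top_of_set (frontier ?S)) (geometric_realization (complex_of (boundary_facets vs))) f"
  proof (rule homeomorphic_map_from_compact)
    show "compact (frontier ?S)" using comp by (rule compact_frontier)
    show "Hausdorff_space (geometric_realization (complex_of (boundary_facets vs)))"
      by (rule Hausdorff_geometric_realization)
    have "continuous_on (frontier ?S) (\<lambda>x. f x u)" for u
      by (cases "u = c0"; cases "u \<in> V") (auto simp: f_def intro!: continuous_intros)
    then have "continuous_on (frontier ?S) f" by (rule continuous_on_coordinatewise_then_product)
    moreover have "f x \<in> realization_points (complex_of (boundary_facets vs))" if x: "x \<in> frontier ?S" for x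
      unfolding realization_boundary_iff
    proof (intro conjI allI impI)
      fix u
      show "0 \<le> f x u" using x B by (auto simp: f_def fr)
      show "f x u = 0" if "u \<notin> set vs" using that V by (auto simp: f_def)
      have "(\<exists>b\<in>Basis. x \<bullet> b = 0) \<or> (\<Sum>b\<in>Basis. x \<bullet> b) = 1" using x by (simp add: fr)
      then show "\<exists>u\<in>set vs. f x u = 0"
      proof
        assume "\<exists>b\<in>Basis. x \<bullet> b = 0"
        then obtain u where "u \<in> V" "x \<bullet> \<beta> u = 0" using surj by metis
        then show ?thesis using V by (intro bexI[of _ u]) (auto simp: f_def)
      qed (use c0 in \<open>auto simp: f_def\<close>)
    qed (rule sumf)
    ultimately show "continuous_map (top_of_set (frontier ?S)) (geometric_realization (complex_of (boundary_facets vs))) f"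
      by (auto simp: geometric_realization_eq continuous_map_in_subtopology)
    show "inj_on f (frontier ?S)"
    proof (rule inj_onI)
      fix x y assume "f x = f y"
      then have "x \<bullet> \<beta> u = y \<bullet> \<beta> u" if "u \<in> V" for u
        using that V(3) unfolding f_def fun_eq_iff by metis
      then show "x = y" using surj by (metis euclidean_eqI)
    qed
    show "topspace (geometric_realization (complex_of (boundary_facets vs))) \<subseteq> f ` frontier ?S"
    proof
      fix y assume "y \<in> topspace (geometric_realization (complex_of (boundary_facets vs)))"
      then have y: "\<And>u. 0 \<le> y u" "\<And>u. u \<notin> set vs \<Longrightarrow> y u = 0" "sum y (set vs) = 1" "\<exists>u\<in>set vs. y u = 0"
        by (auto simp: geometric_realization_eq realization_boundary_iff)
      define x where "x = (\<Sum>u\<in>V. y u *\<^sub>R \<beta> u)"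
      have inner: "x \<bullet> \<beta> w = y w" if "w \<in> V" for w
      proof -
        have "x \<bullet> \<beta> w = (\<Sum>u\<in>V. y u * (\<beta> u \<bullet> \<beta> w))" by (simp add: x_def inner_sum_left)
        also have "\<dots> = (\<Sum>u\<in>V. if u = w then y u else 0)"
          using B that \<beta> by (intro sum.cong refl) (auto simp: inner_Basis bij_betw_def inj_on_def)
        finally show ?thesis using that V(1) by simp
      qed
      have sx: "(\<Sum>b\<in>Basis. x \<bullet> b) = 1 - y c0"
        using y(3) V inner by (simp add: sumB)
      have fx: "f x = y"
        using y(2) V inner sx by (auto simp: f_def fun_eq_iff)
      have "\<forall>b\<in>Basis. 0 \<le> x \<bullet> b" using surj inner y(1) by metis
      moreover have "(\<exists>b\<in>Basis. x \<bullet> b = 0) \<or> (\<Sum>b\<in>Basis. x \<bullet> b) = 1"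
        using y(4) V(4) sx inner B by (metis diff_zero insertE)
      ultimately have "x \<in> frontier ?S" using y(1)[of c0] sx by (simp add: fr)
      then show "y \<in> f ` frontier ?S" using fx by blast
    qed
  qed
  then show ?thesis by (rule homeomorphic_map_imp_homeomorphic_space)
qed

lemma frontier_simplex_homeomorphic_sphere:
  "frontier (convex hull insert 0 (Basis :: 'a::euclidean_space set)) homeomorphic sphere (0::'a) 1"
proof -
  let ?S = "convex hull insert 0 (Basis :: 'a set)"
  obtain a where a: "a \<in> interior ?S" using interior_std_simplex_nonempty by blast
  then have ne: "interior ?S \<noteq> {}" by blast
  have "rel_frontier ?S homeomorphic rel_frontier (cball (0::'a) 1)"
    by (intro homeomorphic_rel_frontiers_convex_bounded_sets)
      (auto simp: aff_dim_nonempty_interior[OF ne] aff_dim_cball finite_imp_bounded_convex_hull)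
  then show ?thesis by (simp add: rel_frontier_nonempty_interior[OF ne])
qed

lemma homeomorphic_imp_homeomorphic_space:
  assumes "S homeomorphic T"
  shows "top_of_set S homeomorphic_space top_of_set T"
proof -
  obtain f g where fg: "homeomorphism S T f g" using assms by (auto simp: homeomorphic_def)
  then have "f ` S \<subseteq> T" "g ` T \<subseteq> S" "continuous_on S f" "continuous_on T g"
    "\<And>x. x \<in> S \<Longrightarrow> g (f x) = x" "\<And>y. y \<in> T \<Longrightarrow> f (g y) = y"
    by (auto simp: homeomorphism_def)
  then have "homeomorphic_maps (top_of_set S) (top_of_set T) f g"
    unfolding homeomorphic_maps_def by (auto simp: continuous_map_in_subtopology)
  then show ?thesis by (auto simp: homeomorphic_space_def)
qed

text \<open>A wedge needs control of base points. The sphere is homogeneous under orthogonal maps,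
  so a rotation corrects an arbitrary homeomorphism until the base point goes to the chosen vertex.
  The dimension enters through the type \<open>'n\<close>, as spheres in \<open>real^'n\<close> are
  used.\<close>

lemma pointed_sphere_boundary:
  fixes vs :: "'v list"
  assumes card: "card (set vs) = CARD('n::finite) + 1" and c: "c \<in> set vs"
  shows "\<exists>h. homeomorphic_map (nsphere (CARD('n) - 1))
      (geometric_realization (complex_of (boundary_facets vs))) h \<and> h sphere_base = vertex_point c"
proof -
  let ?S = "sphere (0 :: real^'n) 1" and ?K = "geometric_realization (complex_of (boundary_facets vs))"
  have "top_of_set ?S homeomorphic_space ?K"
  proof (rule homeomorphic_space_trans)
    show "top_of_set ?S homeomorphic_space top_of_set (frontier (convex hull insert 0 (Basis :: (real^'n) set)))"
      by (rule homeomorphic_space_sym[THEN iffD1, OF homeomorphic_imp_homeomorphic_space[OF frontier_simplex_homeomorphic_sphere]])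
    show "top_of_set (frontier (convex hull insert 0 (Basis :: (real^'n) set))) homeomorphic_space ?K"
      using card by (intro frontier_simplex_homeomorphic_boundary) simp
  qed
  then obtain f where f: "homeomorphic_map (top_of_set ?S) ?K f"
    unfolding homeomorphic_space by (rule exE)
  obtain g' where g': "homeomorphic_map (top_of_set ?S) (nsphere (CARD('n) - 1)) g'"
    using sphere_homeomorphic_nsphere[where 'a = "real^'n"] by auto
  then have "nsphere (CARD('n) - 1) homeomorphic_space top_of_set ?S"
    using homeomorphic_map_imp_homeomorphic_space homeomorphic_space_sym by metis
  then obtain g where g: "homeomorphic_map (nsphere (CARD('n) - 1)) (top_of_set ?S) g"
    unfolding homeomorphic_space by (rule exE)
  have "set vs \<noteq> {c}" using card by auto
  then have "vertex_point c \<in> topspace ?K"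
    using vertex_point_in_boundary[OF c] by (simp add: geometric_realization_eq)
  then obtain a where a: "a \<in> ?S" "f a = vertex_point c"
    using homeomorphic_imp_surjective_map[OF f] unfolding topspace_euclidean_subtopology
    by (metis imageE)
  have gb: "g sphere_base \<in> ?S"
    using g sphere_base_in_nsphere by (metis homeomorphic_imp_surjective_map imageI topspace_euclidean_subtopology)
  obtain \<phi> where \<phi>: "orthogonal_transformation \<phi>" "\<phi> (g sphere_base) = a"
    using orthogonal_transformation_exists_1[of "g sphere_base" a] gb a by (metis mem_sphere_0)
  have "homeomorphic_map (top_of_set ?S) (top_of_set ?S) \<phi>"
  proof (rule homeomorphic_map_from_compact)
    show "continuous_map (top_of_set ?S) (top_of_set ?S) \<phi>"
      using \<phi>(1) orthogonal_transformation_linear[OF \<phi>(1)]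
      by (auto simp: orthogonal_transformation_norm linear_conv_bounded_linear intro: linear_continuous_on)
    show "inj_on \<phi> ?S" using orthogonal_transformation_inj[OF \<phi>(1)] by (rule inj_on_subset) auto
    show "topspace (top_of_set ?S) \<subseteq> \<phi> ` ?S"
    proof
      fix y assume "y \<in> topspace (top_of_set ?S)"
      moreover obtain x where "y = \<phi> x" using orthogonal_transformation_surj[OF \<phi>(1)] by blast
      ultimately show "y \<in> \<phi> ` ?S" using \<phi>(1) by (auto simp: orthogonal_transformation_norm)
    qed
  qed (auto simp: Hausdorff_space_subtopology)
  then have "homeomorphic_map (nsphere (CARD('n) - 1)) ?K (f \<circ> (\<phi> \<circ> g))"
    using f g by (blast intro: homeomorphic_map_compose)
  moreover have "(f \<circ> (\<phi> \<circ> g)) sphere_base = vertex_point c" using \<phi> a by simp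
  ultimately show ?thesis by blast
qed

lemma compact_space_nsphere: "compact_space (nsphere (DIM('a::euclidean_space) - 1))"
proof -
  have "compact_space (top_of_set (sphere (0::'a) 1))" by (simp add: compact_space_subtopology)
  then show ?thesis
    using sphere_homeomorphic_nsphere[where 'a = 'a] homeomorphic_map_imp_homeomorphic_space
      homeomorphic_compact_space by blast
qed

section \<open>Wedges as unions of pieces with one common point\<close>

lemma compact_space_sum_topology:
  assumes "finite I" "\<And>i. i \<in> I \<Longrightarrow> compact_space (X i)"
  shows "compact_space (sum_topology X I)"
proof -
  have "compactin (sum_topology X I) (\<Union>i\<in>I. Pair i ` topspace (X i))"
    using assms by (intro compactin_Union)
      (auto intro!: image_compactin[OF _ continuous_map_component_injection] simp: compact_space_def)
  moreover have "(\<Union>i\<in>I. Pair i ` topspace (X i)) = topspace (sum_topology X I)" by auto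
  ultimately show ?thesis by (simp add: compact_space_def)
qed

text \<open>The finite sum of compact pieces maps onto the Hausdorff space \<open>Y\<close>, so this
  is a quotient map. Distinct pieces meet only in \<open>c\<close>, so the map identifies precisely
  the base points, as the wedge relation does.\<close>

lemma wedge_sum_homeomorphic_space:
  assumes I: "finite I" and X: "\<And>i. i \<in> I \<Longrightarrow> compact_space (X i) \<and> p i \<in> topspace (X i)"
    and Y: "Hausdorff_space Y" "topspace Y = (\<Union>i\<in>I. P i)"
    and h: "\<And>i. i \<in> I \<Longrightarrow> homeomorphic_map (X i) (subtopology Y (P i)) (h i)"
    and base: "\<And>i. i \<in> I \<Longrightarrow> h i (p i) = c"
    and Int: "\<And>i j. i \<in> I \<Longrightarrow> j \<in> I \<Longrightarrow> i \<noteq> j \<Longrightarrow> P i \<inter> P j = {c}"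
  shows "wedge_sum I X p homeomorphic_space Y"
proof -
  let ?S = "sum_topology X I"
  define r where "r = Id_on (topspace ?S) \<union> {((i, p i), (j, p j)) |i j. i \<in> I \<and> j \<in> I}"
  have eq: "equiv (topspace ?S) r"
    unfolding r_def using X by (intro equiv_wedge_sum) auto
  define q where "q = (\<lambda>(i, x). h i x)"
  have h_img: "h i ` topspace (X i) = P i" if "i \<in> I" for i
    using homeomorphic_imp_surjective_map[OF h[OF that]] Y that by auto
  have h_inj: "inj_on (h i) (topspace (X i))" if "i \<in> I" for i
    using homeomorphic_imp_injective_map[OF h[OF that]] .
  have "quotient_map ?S (wedge_sum I X p) (\<lambda>x. r `` {x})"
    unfolding wedge_sum_def using quotient_map_quotient_topology[OF eq] by (simp add: r_def)
  moreover have "quotient_map ?S Y q"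
  proof (rule continuous_imp_quotient_map)
    show "continuous_map ?S Y q"
      unfolding continuous_map_def
    proof (intro conjI allI impI)
      show "q \<in> topspace ?S \<rightarrow> topspace Y" using h_img Y by (force simp: q_def)
      fix U assume U: "openin Y U"
      have "openin (X i) {x \<in> topspace (X i). h i x \<in> U}" if "i \<in> I" for i
      proof -
        have "continuous_map (X i) Y (h i)"
          using homeomorphic_imp_continuous_map[OF h[OF that]] by (simp add: continuous_map_in_subtopology)
        then show ?thesis using U by (rule openin_continuous_map_preimage)
      qed
      then show "openin ?S {x \<in> topspace ?S. q x \<in> U}"
        by (simp add: openin_sum_topology q_def)
    qed
    show "compact_space ?S" using I X by (intro compact_space_sum_topology) auto
    have "q ` topspace ?S = (\<Union>i\<in>I. h i ` topspace (X i))"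
      by (auto simp: q_def Sigma_def image_UN)
    then show "q ` topspace ?S = topspace Y" using h_img Y by simp
  qed (rule Y)
  moreover have "r `` {a} = r `` {b} \<longleftrightarrow> q a = q b" if ab: "a \<in> topspace ?S" "b \<in> topspace ?S" for a b
  proof -
    obtain i x j y where ij: "a = (i, x)" "b = (j, y)" "i \<in> I" "j \<in> I" "x \<in> topspace (X i)" "y \<in> topspace (X j)"
      using ab by auto
    have "r `` {a} = r `` {b} \<longleftrightarrow> (a, b) \<in> r" using eq_equiv_class_iff[OF eq] ab by blast
    also have "\<dots> \<longleftrightarrow> a = b \<or> (x = p i \<and> y = p j)" using ij ab by (auto simp: r_def)
    also have "\<dots> \<longleftrightarrow> h i x = h j y"
    proof (cases "i = j")
      case True
      then show ?thesis using h_inj[OF ij(3)] ij base by (auto simp: inj_on_def)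
    next
      case False
      have "x = p i \<and> y = p j" if e: "h i x = h j y"
      proof -
        have "h i x \<in> P i \<inter> P j" using h_img ij e by (metis IntI imageI)
        then have "h i x = c" "h j y = c" using Int[OF ij(3,4) False] e by auto
        then show ?thesis using h_inj ij base X by (metis inj_onD)
      qed
      then show ?thesis using False ij base by auto
    qed
    finally show ?thesis by (simp add: q_def ij)
  qed
  ultimately show ?thesis by (rule homeomorphic_space_same_fibres)
qed

section \<open>Components of a geometric realization\<close>

lemma realization_relabel:
  fixes K :: "'v set set" and f :: "'v \<Rightarrow> 'w"
  assumes fin: "finite (\<Union>K)" and inj: "inj_on f (\<Union>K)"
  shows "geometric_realization K homeomorphic_space geometric_realization ((`) f ` K)"
proof -
  define V where "V = \<Union>K"
  define g where "g = inv_into V f"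
  have gf: "g (f v) = v" if "v \<in> V" for v
    using that inj by (simp add: g_def V_def)
  have UnI: "\<Union>((`) f ` K) = f ` V" by (auto simp: V_def)
  have V: "finite V" "\<Union>K \<subseteq> V" "finite (f ` V)" "\<Union>((`) f ` K) \<subseteq> f ` V"
    using fin UnI by (auto simp: V_def)
  note iffK = realization_points_iff[OF V(1,2)] and iffL = realization_points_iff[OF V(3,4)]
  define F :: "('v \<Rightarrow> real) \<Rightarrow> 'w \<Rightarrow> real" where "F x = (\<lambda>w. if w \<in> f ` V then x (g w) else 0)" for x
  define G :: "('w \<Rightarrow> real) \<Rightarrow> 'v \<Rightarrow> real" where "G y = (\<lambda>v. if v \<in> V then y (f v) else 0)" for y
  have GF: "G (F x) = x" if "x \<in> realization_points K" for x
    using that by (auto simp: iffK F_def G_def gf fun_eq_iff)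
  have FG: "F (G y) = y" if "y \<in> realization_points ((`) f ` K)" for y
    using that by (auto simp: iffL F_def G_def gf fun_eq_iff)
  have injV: "inj_on f V" using inj by (simp add: V_def)
  have "F x \<in> realization_points ((`) f ` K)" if "x \<in> realization_points K" for x
  proof -
    have "sum (F x) (f ` V) = sum x V"
      using sum.reindex[OF injV, of "F x"] by (simp add: F_def gf)
    moreover have "supp (F x) = f ` supp x"
    proof -
      have "supp x \<subseteq> V" using that by (auto simp: iffK)
      have "F x (f v) = x v" if "v \<in> V" for v using that by (simp add: F_def gf)
      then have *: "{v \<in> V. F x (f v) \<noteq> 0} = supp x" using \<open>supp x \<subseteq> V\<close> by auto
      have "supp (F x) = f ` {v \<in> V. F x (f v) \<noteq> 0}" by (auto simp: F_def)
      then show ?thesis by (simp only: *)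
    qed
    ultimately show ?thesis using that by (auto simp: iffL iffK F_def)
  qed
  moreover have "G y \<in> realization_points K" if "y \<in> realization_points ((`) f ` K)" for y
  proof -
    have "sum (G y) V = sum y (f ` V)"
      using sum.reindex[OF injV, of y] by (simp add: G_def)
    moreover have "supp y \<in> (`) f ` K" using that by (simp add: iffL)
    then obtain \<rho> where \<rho>: "\<rho> \<in> K" "supp y = f ` \<rho>" by (rule imageE)
    have "supp (G y) = \<rho>"
    proof -
      have "supp (G y) = {v \<in> V. f v \<in> f ` \<rho>}" using \<rho>(2) by (auto simp: G_def)
      also have "\<dots> = \<rho>" using \<rho>(1) V(2) injV by (auto simp: inj_on_def)
      finally show ?thesis .
    qed
    ultimately show ?thesis using that \<rho> by (auto simp: iffL iffK G_def)
  qed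
  moreover have "continuous_on S F" for S
  proof -
    have "continuous_on S (\<lambda>x. F x w)" for w
      by (cases "w \<in> f ` V") (auto simp: F_def intro: continuous_on_product_then_coordinatewise[OF continuous_on_id])
    then show ?thesis by (rule continuous_on_coordinatewise_then_product)
  qed
  moreover have "continuous_on S G" for S
  proof -
    have "continuous_on S (\<lambda>x. G x w)" for w
      by (cases "w \<in> V") (auto simp: G_def intro: continuous_on_product_then_coordinatewise[OF continuous_on_id])
    then show ?thesis by (rule continuous_on_coordinatewise_then_product)
  qed
  ultimately have "homeomorphic_maps (geometric_realization K) (geometric_realization ((`) f ` K)) F G"
    unfolding homeomorphic_maps_def geometric_realization_eq
    using GF FG by (auto simp: continuous_map_in_subtopology)
  then show ?thesis by (auto simp: homeomorphic_space_def)
qed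

lemma connected_component_segment:
  fixes K :: "'v set set"
  assumes fin: "finite (\<Union>K)" and dc: "down_closed K"
    and x: "x \<in> realization_points K" and y: "y \<in> realization_points K"
    and xy: "supp x \<union> supp y \<in> K"
  shows "connected_component (realization_points K) x y"
proof -
  define V where "V = \<Union>K"
  have V: "finite V" "\<Union>K \<subseteq> V" using fin by (auto simp: V_def)
  note iffK = realization_points_iff[OF V]
  define p where "p t = (\<lambda>v. (1 - t) * x v + t * y v)" for t :: real
  have "continuous_on {0..1} p"
    unfolding p_def by (intro continuous_on_coordinatewise_then_product continuous_on_add
        continuous_on_mult continuous_on_diff continuous_on_const continuous_on_id)
  then have "connected (p ` {0..1})" by (intro connected_continuous_image) auto
  moreover have "p ` {0..1} \<subseteq> realization_points K"
  proof clarify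
    fix t :: real assume t: "t \<in> {0..1}"
    have s: "sum (p t) V = 1"
      using x y by (simp add: p_def iffK sum.distrib flip: sum_distrib_left)
    then have "supp (p t) \<noteq> {}"
      by (metis (mono_tags, lifting) Collect_empty_eq sum.neutral zero_neq_one)
    moreover have "supp (p t) \<subseteq> supp x \<union> supp y" by (auto simp: p_def)
    ultimately have "supp (p t) \<in> K" using down_closedD[OF dc xy] by blast
    with s t show "p t \<in> realization_points K" using x y by (auto simp: iffK p_def)
  qed
  moreover have "p 0 = x" "p 1 = y" by (auto simp: p_def)
  ultimately show ?thesis unfolding connected_component_def
    by (intro exI[of _ "p ` {0..1}"]) (metis atLeastAtMost_iff imageI order_refl zero_le_one)
qed

text \<open>Every point is joined by a segment to a vertex of its support, and vertices are joined
  along paths of edges.\<close>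

lemma connected_realization_points:
  fixes K :: "'v set set"
  assumes fin: "finite (\<Union>K)" and dc: "down_closed K"
    and edges: "\<And>v. v \<in> \<Union>K \<Longrightarrow> (\<lambda>v w. {v, w} \<in> K)\<^sup>*\<^sup>* v0 v"
  shows "connected (realization_points K)"
proof -
  define e :: "'v \<Rightarrow> 'v \<Rightarrow> real" where "e v = (\<lambda>u. if u = v then 1 else 0)" for v
  have V: "finite (\<Union>K)" "\<Union>K \<subseteq> \<Union>K" using fin by auto
  note iffK = realization_points_iff[OF V]
  have supp_e: "supp (e v) = {v}" for v by (auto simp: e_def)
  have e_in: "e v \<in> realization_points K" if "{v} \<in> K" for v
    using that by (auto simp: realization_points_def supp_e) (auto simp: e_def)
  have edge: "connected_component (realization_points K) (e v) (e w)" if "{v, w} \<in> K" for v w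
    using that down_closedD[OF dc that]
    by (intro connected_component_segment[OF fin dc] e_in) (auto simp: supp_e insert_commute)
  have path: "connected_component (realization_points K) (e v) (e w)"
    if "(\<lambda>v w. {v, w} \<in> K)\<^sup>*\<^sup>* v w" "{v} \<in> K" for v w
    using that
  proof (induction rule: rtranclp_induct)
    case base
    then show ?case using e_in by simp
  next
    case (step u w)
    then show ?case using edge connected_component_trans by metis
  qed
  have to0: "connected_component (realization_points K) (e v0) x"
    if x: "x \<in> realization_points K" for x
  proof -
    have "supp x \<in> K" "supp x \<noteq> {}" using x
      by (auto simp: iffK) (metis (mono_tags, lifting) sum.neutral zero_neq_one)
    then obtain v where v: "v \<in> supp x" by blast
    have vK: "{v} \<in> K" using down_closedD[OF dc \<open>supp x \<in> K\<close>] v by simp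
    have "connected_component (realization_points K) (e v) x"
      using v vK x \<open>supp x \<in> K\<close>
      by (intro connected_component_segment[OF fin dc] e_in) (auto simp: supp_e insert_absorb)
    moreover have r: "(\<lambda>v w. {v, w} \<in> K)\<^sup>*\<^sup>* v0 v" using vK edges by blast
    moreover have "{v0} \<in> K"
      using r vK
    proof (cases rule: converse_rtranclpE)
      case (step z)
      then show ?thesis using down_closedD[OF dc step(1), of "{v0}"] by simp
    qed simp
    ultimately show ?thesis using path connected_component_trans by metis
  qed
  show ?thesis
    unfolding connected_iff_connected_component
    using to0 connected_component_sym connected_component_trans by metis
qed

text \<open>The total mass on \<open>H\<close> is a continuous function, and by \<open>sep\<close>
  its only values are 0 and 1. The set where it equals 1 is therefore clopen; being connected as
  well, it is the component of \<open>z\<close>.\<close>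

lemma component_space_eq:
  fixes K :: "'v set set"
  assumes fin: "finite (\<Union>K)" and dc: "down_closed K"
    and C: "C \<in> connected_components_of (geometric_realization K)"
    and z: "z \<in> C" "supp z \<inter> H \<noteq> {}"
    and sep: "\<And>\<rho>. \<rho> \<in> K \<Longrightarrow> \<rho> \<subseteq> H \<or> \<rho> \<inter> H = {}"
    and conn: "connected (realization_points {\<rho> \<in> K. \<rho> \<subseteq> H})"
  shows "subtopology (geometric_realization K) C = geometric_realization {\<rho> \<in> K. \<rho> \<subseteq> H}"
proof -
  let ?X = "geometric_realization K"
  define V where "V = \<Union>K"
  have V: "finite V" "\<Union>K \<subseteq> V" "\<Union>{\<rho> \<in> K. \<rho> \<subseteq> H} \<subseteq> V" using fin by (auto simp: V_def)
  note iffK = realization_points_iff[OF V(1,2)] and iffL = realization_points_iff[OF V(1,3)]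
  define A where "A = realization_points {\<rho> \<in> K. \<rho> \<subseteq> H}"
  define h where "h x = sum x (V \<inter> H)" for x :: "'v \<Rightarrow> real"
  have X: "topspace ?X = realization_points K" by (simp add: geometric_realization_eq)
  have AX: "A \<subseteq> topspace ?X" by (auto simp: X A_def iffK iffL)
  have C_sub: "C \<subseteq> topspace ?X"
    using C by (simp add: connected_components_of_subset)
  have h1: "h x = 1" if "x \<in> A" for x
  proof -
    have "h x = sum x V" unfolding h_def
      using that V by (intro sum.mono_neutral_left) (auto simp: A_def iffL)
    then show ?thesis using that by (simp add: A_def iffL)
  qed
  have h0: "h x = 0" if "x \<in> topspace ?X" "x \<notin> A" for x
  proof -
    have "supp x \<inter> H = {}" using that sep[of "supp x"] by (auto simp: X A_def iffK iffL)
    then show ?thesis unfolding h_def by (intro sum.neutral) auto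
  qed
  have cont: "continuous_map ?X euclideanreal h"
    unfolding geometric_realization_eq h_def
    by (simp only: continuous_map_iff_continuous)
      (intro continuous_on_sum continuous_on_product_then_coordinatewise[OF continuous_on_id])
  have "closedin ?X {x \<in> topspace ?X. h x \<in> {1}}" "closedin ?X {x \<in> topspace ?X. h x \<in> {0}}"
    by (intro closedin_continuous_map_preimage[OF cont]; simp)+
  moreover have "{x \<in> topspace ?X. h x \<in> {1}} = A" using h1 h0 AX by force
  moreover have "{x \<in> topspace ?X. h x \<in> {0}} = topspace ?X - A" using h1 h0 AX by force
  ultimately have clopen: "closedin ?X A" "openin ?X A"
    using AX by (simp_all only: openin_closedin_eq)
  have "z \<in> topspace ?X" using z C_sub by auto
  then have zA: "z \<in> A" using z sep[of "supp z"] by (auto simp: X A_def iffK iffL)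
  have "connectedin ?X C" using C by (simp add: connectedin_connected_components_of)
  then have "C \<subseteq> A"
    using connectedin_clopen_cases[OF _ clopen, of C] zA z by (auto simp: disjnt_def)
  moreover have "A \<subseteq> C"
  proof -
    have "connectedin ?X A"
      using conn AX by (simp add: connectedin_subtopology geometric_realization_eq A_def)
    then show ?thesis using connected_components_of_maximal[OF C] z zA by (auto simp: disjnt_def)
  qed
  ultimately have "C = A" by auto
  then show ?thesis
    using AX by (simp add: geometric_realization_eq A_def X subtopology_subtopology Int_absorb1)
qed

section \<open>The components of the circulant graph\<close>

text \<open>The shift by one selects representatives in \<open>1..n\<close>, so that the vertex
  \<open>n\<close> stands for the residue 0.\<close>

definition residue_vertex :: "nat \<Rightarrow> int \<Rightarrow> nat" where
  "residue_vertex n i = nat ((i - 1) mod int n) + 1"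

lemma residue_vertex_in: "n > 0 \<Longrightarrow> residue_vertex n i \<in> {1..n}"
proof -
  assume "n > 0"
  then have "0 \<le> (i - 1) mod int n" "(i - 1) mod int n < int n" by auto
  then show ?thesis unfolding residue_vertex_def by auto
qed

lemma residue_vertex_cong: "n > 0 \<Longrightarrow> [int (residue_vertex n i) = i] (mod int n)"
proof -
  assume "n > 0"
  then have "int (residue_vertex n i) = (i - 1) mod int n + 1"
    by (simp add: residue_vertex_def)
  moreover have "[(i - 1) mod int n + 1 = (i - 1) + 1] (mod int n)"
    by (intro cong_add) (auto simp: cong_def)
  ultimately show ?thesis by simp
qed

lemma residue_vertex_eq_iff:
  "n > 0 \<Longrightarrow> residue_vertex n i = residue_vertex n j \<longleftrightarrow> [i = j] (mod int n)"
proof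
  assume "n > 0" "residue_vertex n i = residue_vertex n j"
  then show "[i = j] (mod int n)"
    using residue_vertex_cong by (metis cong_sym cong_trans)
next
  assume "n > 0" "[i = j] (mod int n)"
  then have "[i - 1 = j - 1] (mod int n)" by (intro cong_diff) auto
  then show "residue_vertex n i = residue_vertex n j"
    by (simp add: residue_vertex_def cong_def)
qed

lemma residue_vertex_of_vertex: "v \<in> {1..n} \<Longrightarrow> residue_vertex n (int v) = v"
  by (auto simp: residue_vertex_def of_nat_diff)

lemma adj_circulant_iff:
  assumes a: "0 < a" "10 * a < n"
  shows "adj (circulant_graph n (3 * a) (5 * a)) v w \<longleftrightarrow> v \<in> {1..n} \<and> w \<in> {1..n} \<and>
    (\<exists>c\<in>{-5, -3, 3, 5}. [int v = int w + c * int a] (mod int n))"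
proof -
  have c: "[int v = int w + c * int a] (mod int n) \<longleftrightarrow> (int v - int w) mod int n = (c * int a) mod int n" for c
    by (simp only: cong_iff_dvd_diff cong_def[symmetric]) (simp add: algebra_simps)
  have 1: "(3 * int a) mod int n = 3 * int a" "(5 * int a) mod int n = 5 * int a"
    using a by auto
  have "(-3 * int a) mod int n = (int n - 3 * int a) mod int n"
    "(-5 * int a) mod int n = (int n - 5 * int a) mod int n"
    by (simp_all add: mod_diff_eq[symmetric, of "int n"] minus_mod_self1)
  moreover have "(int n - 3 * int a) mod int n = int n - 3 * int a"
    "(int n - 5 * int a) mod int n = int n - 5 * int a"
    using a by (intro mod_pos_pos_trivial; simp)+
  ultimately show ?thesis
    unfolding circulant_graph_def by (auto simp: c 1)
qed

lemma neighborhood_complex_circulant: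
  assumes a: "0 < a" "10 * a < n"
  shows "neighborhood_complex (circulant_graph n (3 * a) (5 * a)) =
    {\<sigma>. \<sigma> \<noteq> {} \<and> (\<exists>i. \<sigma> \<subseteq> (\<lambda>j. residue_vertex n (i + 2 * int a * int j)) ` {0, 1, 4, 5})}"
    (is "?L = ?R")
proof (intro equalityI subsetI)
  have n: "n > 0" using a by auto
  fix \<sigma>
  {
    assume "\<sigma> \<in> ?L"
    then obtain w where w: "\<sigma> \<noteq> {}" "\<forall>v\<in>\<sigma>. adj (circulant_graph n (3 * a) (5 * a)) v w"
      by (auto simp: neighborhood_complex_def)
    define i where "i = int w - 5 * int a"
    have "v \<in> (\<lambda>j. residue_vertex n (i + 2 * int a * int j)) ` {0, 1, 4, 5}" if "v \<in> \<sigma>" for v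
    proof -
      obtain c where c: "c \<in> {-5, -3, 3, 5}" "v \<in> {1..n}" "[int v = int w + c * int a] (mod int n)"
        using w(2)[rule_format, OF \<open>v \<in> \<sigma>\<close>] unfolding adj_circulant_iff[OF a] by blast
      then have "v = residue_vertex n (int w + c * int a)"
        using residue_vertex_of_vertex residue_vertex_eq_iff[OF n] by metis
      moreover have "\<exists>j\<in>{0::nat, 1, 4, 5}. int w + c * int a = i + 2 * int a * int j"
        using c(1) by (auto simp: i_def)
      ultimately show ?thesis by auto
    qed
    then show "\<sigma> \<in> ?R" using w by auto
  next
    assume "\<sigma> \<in> ?R"
    then obtain i where i: "\<sigma> \<noteq> {}" "\<sigma> \<subseteq> (\<lambda>j. residue_vertex n (i + 2 * int a * int j)) ` {0, 1, 4, 5}"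
      by auto
    define w where "w = residue_vertex n (i + 5 * int a)"
    have "adj (circulant_graph n (3 * a) (5 * a)) v w" if "v \<in> \<sigma>" for v
    proof -
      have "v \<in> (\<lambda>j. residue_vertex n (i + 2 * int a * int j)) ` {0, 1, 4, 5}"
        using i(2) that by (rule subsetD)
      then obtain j where j: "v = residue_vertex n (i + 2 * int a * int j)" "j \<in> {0, 1, 4, 5}"
        by (rule imageE)
      \<comment> \<open>The positions 0, 1, 4, 5 on the walk with step \<open>2a\<close> from
        \<open>w - 5a\<close> correspond to the offsets -5, -3, 3, 5 in units of
        \<open>a\<close>.\<close>
      define c where "c = 2 * int j - 5"
      have c: "c \<in> {-5, -3, 3, 5}" "2 * int j = 5 + c" using j(2) by (auto simp: c_def)
      have "[int v = i + 2 * int a * int j] (mod int n)"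
        using residue_vertex_cong[OF n] j by blast
      also have "i + 2 * int a * int j = (i + 5 * int a) + c * int a"
        using arg_cong[OF c(2), of "\<lambda>x. int a * x"] by (simp add: algebra_simps)
      also have "[\<dots> = int w + c * int a] (mod int n)"
        using residue_vertex_cong[OF n] unfolding w_def by (intro cong_add) (auto intro: cong_sym)
      finally show ?thesis
        using residue_vertex_in[OF n] j(1) c(1) by (auto simp: adj_circulant_iff[OF a] w_def)
    qed
    moreover have "finite \<sigma>" using i(2) finite_subset by blast
    moreover have "\<sigma> \<subseteq> {1..n}" "w \<in> {1..n}" using i(2) residue_vertex_in[OF n] by (auto simp: w_def)
    moreover have "verts (circulant_graph n (3 * a) (5 * a)) = {1..n}" by (simp add: circulant_graph_def)
    ultimately show "\<sigma> \<in> ?L"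
      unfolding neighborhood_complex_def using i(1) by blast
  }
qed

lemma cong_mult_iff_cong_div_gcd:
  fixes n c x y :: int
  assumes "n > 0"
  shows "[c * x = c * y] (mod n) \<longleftrightarrow> [x = y] (mod (n div gcd n c))"
proof -
  define d where "d = gcd n c"
  have d: "d \<noteq> 0" using assms by (simp add: d_def)
  obtain n' c' where nc: "n = n' * d" "c = c' * d" "coprime n' c'"
    using gcd_coprime_exists[of n c] d unfolding d_def by blast
  have "[c * x = c * y] (mod n) \<longleftrightarrow> d * n' dvd d * (c' * (x - y))"
    by (simp add: cong_iff_dvd_diff nc algebra_simps)
  also have "\<dots> \<longleftrightarrow> n' dvd c' * (x - y)" using d by simp
  also have "\<dots> \<longleftrightarrow> n' dvd x - y" using nc(3) by (simp add: coprime_dvd_mult_right_iff)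
  also have "\<dots> \<longleftrightarrow> [x = y] (mod (n div d))" using nc(1) d by (simp add: cong_iff_dvd_diff)
  finally show ?thesis by (simp add: d_def)
qed

text \<open>The walk from \<open>x0\<close> in steps of \<open>2a\<close> has period
  \<open>m\<close>. Each simplex lies in one orbit of such steps, so it is contained in the orbit
  \<open>H\<close> of \<open>x0\<close> or disjoint from it; the part over \<open>H\<close> is the
  component.\<close>

lemma component_of_circulant:
  assumes a: "0 < a" "10 * a < n"
    and Z: "Z \<in> component_spaces (geometric_realization (neighborhood_complex (circulant_graph n (3 * a) (5 * a))))"
  shows "Z homeomorphic_space
         geometric_realization (complex_of (circulant_facets (n div gcd n (2 * a))))"
proof -
  define K where "K = neighborhood_complex (circulant_graph n (3 * a) (5 * a))"
  define m where "m = n div gcd n (2 * a)"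
  have n: "n > 0" using a by auto
  have m: "m > 0" using n unfolding m_def by (metis dvd_div_eq_0_iff gcd_dvd1 gr0I less_irrefl)
  have K_iff: "\<sigma> \<in> K \<longleftrightarrow> \<sigma> \<noteq> {} \<and> (\<exists>i. \<sigma> \<subseteq> (\<lambda>j. residue_vertex n (i + 2 * int a * int j)) ` {0, 1, 4, 5})" for \<sigma>
    by (simp add: K_def neighborhood_complex_circulant[OF a])
  have fin: "finite (\<Union>K)"
    by (rule finite_subset[of _ "{1..n}"]) (auto simp: K_def neighborhood_complex_def circulant_graph_def)
  have dc: "down_closed K"
    unfolding down_closed_def
  proof (intro ballI allI impI)
    fix \<rho> \<tau> assume "\<rho> \<in> K" "\<tau> \<noteq> {}" "\<tau> \<subseteq> \<rho>"
    then obtain i where "\<rho> \<subseteq> (\<lambda>j. residue_vertex n (i + 2 * int a * int j)) ` {0, 1, 4, 5}"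
      unfolding K_iff by blast
    with \<open>\<tau> \<subseteq> \<rho>\<close> have "\<tau> \<subseteq> (\<lambda>j. residue_vertex n (i + 2 * int a * int j)) ` {0, 1, 4, 5}"
      by (rule order_trans)
    then show "\<tau> \<in> K" unfolding K_iff using \<open>\<tau> \<noteq> {}\<close> by blast
  qed
  obtain C where C: "C \<in> connected_components_of (geometric_realization K)"
    "Z = subtopology (geometric_realization K) C"
    using Z by (auto simp: component_spaces_def K_def)
  obtain z where z: "z \<in> C" using C(1) nonempty_connected_components_of by blast
  have "z \<in> realization_points K"
    using z C(1) connected_components_of_subset by (fastforce simp: geometric_realization_eq)
  then have suppz: "supp z \<in> K" by (simp add: realization_points_def)
  then obtain x0 where x0: "x0 \<in> supp z" "x0 \<in> {1..n}"
    unfolding K_iff using residue_vertex_in[OF n] by blast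
  define \<pi> where "\<pi> k = residue_vertex n (int x0 + 2 * int a * int k)" for k :: nat
  have pi_eq: "\<pi> k = \<pi> l \<longleftrightarrow> [k = l] (mod m)" for k l
  proof -
    have "\<pi> k = \<pi> l \<longleftrightarrow> [2 * int a * int k = 2 * int a * int l] (mod int n)"
      by (simp add: \<pi>_def residue_vertex_eq_iff[OF n] cong_add_lcancel)
    also have "\<dots> \<longleftrightarrow> [int k = int l] (mod (int n div gcd (int n) (2 * int a)))"
      using n by (intro cong_mult_iff_cong_div_gcd) auto
    also have "int n div gcd (int n) (2 * int a) = int m"
      by (simp add: m_def zdiv_int flip: gcd_int_int_eq)
    finally show ?thesis by (simp add: cong_int_iff)
  qed
  have pi_mod: "\<pi> (k mod m) = \<pi> k" for k by (simp add: pi_eq)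
  define H where "H = range \<pi>"
  define fc where "fc x = {x, (x + 1) mod m, (x + 4) mod m, (x + 5) mod m}" for x
  have L_iff: "\<tau> \<in> complex_of (circulant_facets m) \<longleftrightarrow> \<tau> \<noteq> {} \<and> (\<exists>x<m. \<tau> \<subseteq> fc x)" for \<tau>
    by (auto simp: complex_of_def circulant_facets_def fc_def)
  have fc_lt: "fc x \<subseteq> {..<m}" if "x < m" for x using that m by (auto simp: fc_def)
  have pi_fc: "\<pi> ` fc x = (\<lambda>j. residue_vertex n (int x0 + 2 * int a * int x + 2 * int a * int j)) ` {0, 1, 4, 5}" for x
    by (simp add: fc_def pi_mod) (simp add: \<pi>_def algebra_simps)
  have image_in: "\<pi> ` \<tau> \<in> K \<and> \<pi> ` \<tau> \<subseteq> H" if "\<tau> \<in> complex_of (circulant_facets m)" for \<tau>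
    using that pi_fc unfolding L_iff K_iff H_def by (metis image_is_empty image_mono subset_UNIV)
  have meets: "\<rho> \<in> (`) \<pi> ` complex_of (circulant_facets m)" 
    if "\<rho> \<in> K" and meet: "\<rho> \<inter> H \<noteq> {}" for \<rho>
  proof -
    obtain i where i: "\<rho> \<noteq> {}" "\<rho> \<subseteq> (\<lambda>j. residue_vertex n (i + 2 * int a * int j)) ` {0, 1, 4, 5}"
      using \<open>\<rho> \<in> K\<close> by (auto simp: K_iff)
    obtain l j where lj: "\<pi> l = residue_vertex n (i + 2 * int a * int j)"
      using meet i(2) unfolding H_def by blast
    \<comment> \<open>This is the position \<open>l - j\<close> modulo \<open>m\<close> at which the
      facet starts; adding \<open>m * j\<close> keeps the subtraction of naturals from
      truncating.\<close>
    define k where "k = (l + m * j - j) mod m"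
    have "j \<le> m * j" using m by simp
    then have "l + m * j - j + j = l + m * j" by linarith
    then have "[k + j = l] (mod m)"
      unfolding k_def cong_def by (metis mod_add_left_eq mod_mult_self2)
    then have "\<pi> (k + j) = residue_vertex n (i + 2 * int a * int j)" using lj pi_eq by metis
    then have "[int x0 + 2 * int a * int (k + j) = i + 2 * int a * int j] (mod int n)"
      by (simp only: \<pi>_def residue_vertex_eq_iff[OF n])
    then have *: "[int x0 + 2 * int a * int k = i] (mod int n)"
      by (simp add: algebra_simps cong_iff_dvd_diff)
    have "residue_vertex n (int x0 + 2 * int a * int k + 2 * int a * int j') =
          residue_vertex n (i + 2 * int a * int j')" for j'
      using * by (simp add: residue_vertex_eq_iff[OF n] cong_add_rcancel)
    then have "\<rho> \<subseteq> \<pi> ` fc k" using i(2) by (simp add: pi_fc)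
    moreover have "k < m" using m by (simp add: k_def)
    ultimately obtain \<tau> where \<tau>: "\<tau> \<subseteq> fc k" "\<rho> = \<pi> ` \<tau>" "k < m"
      by (auto simp: subset_image_iff)
    then have "\<tau> \<in> complex_of (circulant_facets m)" using i(1) unfolding L_iff by blast
    then show ?thesis using \<tau>(2) by blast
  qed
  have KH: "{\<rho> \<in> K. \<rho> \<subseteq> H} = (`) \<pi> ` complex_of (circulant_facets m)" (is "?K = _")
  proof (intro equalityI subsetI)
    fix \<rho> assume "\<rho> \<in> ?K"
    then show "\<rho> \<in> (`) \<pi> ` complex_of (circulant_facets m)"
      using meets[of \<rho>] by (auto simp: K_iff)
  qed (use image_in in auto)
  have "connected (realization_points ?K)"
  proof (rule connected_realization_points)
    show "finite (\<Union>?K)" using fin by (rule finite_subset[rotated]) auto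
    show "down_closed ?K" using dc unfolding down_closed_def by (metis (no_types, lifting) mem_Collect_eq order_trans)
    have "(\<lambda>v w. {v, w} \<in> ?K)\<^sup>*\<^sup>* (\<pi> 0) (\<pi> k)" for k
    proof (induction k)
      case (Suc k)
      \<comment> \<open>Consecutive positions share a facet, so the walk itself is a path of edges
        through all of \<open>H\<close>.\<close>
      have "{k mod m, Suc k mod m} \<subseteq> fc (k mod m)" by (auto simp: fc_def mod_simps)
      then have "{k mod m, Suc k mod m} \<in> complex_of (circulant_facets m)"
        unfolding L_iff using m by (metis insert_not_empty mod_less_divisor)
      from image_in[OF this] have "{\<pi> k, \<pi> (Suc k)} \<in> ?K" by (simp add: pi_mod)
      then show ?case using Suc by (rule rtranclp.rtrancl_into_rtrancl[rotated])
    qed simp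
    then show "(\<lambda>v w. {v, w} \<in> ?K)\<^sup>*\<^sup>* (\<pi> 0) v" if "v \<in> \<Union>?K" for v
      using that by (auto simp: H_def)
  qed
  moreover have "\<rho> \<subseteq> H \<or> \<rho> \<inter> H = {}" if "\<rho> \<in> K" for \<rho>
    using meets[OF that] image_in by blast
  moreover have "x0 = \<pi> 0" using x0(2) by (simp add: \<pi>_def residue_vertex_of_vertex)
  then have "supp z \<inter> H \<noteq> {}" using x0(1) by (auto simp: H_def)
  ultimately have "Z = geometric_realization ?K"
    using component_space_eq[OF fin dc C(1) z] C(2) by blast
  moreover have "inj_on \<pi> (\<Union>(complex_of (circulant_facets m)))"
  proof (rule inj_on_subset)
    show "inj_on \<pi> {..<m}"
      by (auto simp: inj_on_def pi_eq intro: cong_less_modulus_unique_nat)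
    show "\<Union>(complex_of (circulant_facets m)) \<subseteq> {..<m}"
    proof
      fix k assume "k \<in> \<Union>(complex_of (circulant_facets m))"
      then obtain \<tau> where "k \<in> \<tau>" "\<tau> \<in> complex_of (circulant_facets m)" by (rule UnionE)
      then obtain x where "k \<in> \<tau>" "\<tau> \<subseteq> fc x" "x < m" using L_iff by auto
      then show "k \<in> {..<m}" using fc_lt by blast
    qed
  qed
  ultimately show ?thesis
    unfolding KH m_def[symmetric]
    using realization_relabel[OF finite_complex_of] homeomorphic_space_sym by metis
qed

section \<open>The homotopy types\<close>

lemma subtopology_geometric_realization:
  assumes "realization_points L \<subseteq> realization_points K"
  shows "subtopology (geometric_realization K) (realization_points L) = geometric_realization L"
  using assms by (simp add: geometric_realization_eq subtopology_subtopology Int_absorb1)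

lemma wedge_of_boundaries:
  fixes V :: "nat \<Rightarrow> 'v list"
  assumes V: "\<And>i. i \<in> {1..k} \<Longrightarrow> card (set (V i)) = CARD('n::finite) + 1 \<and> c \<in> set (V i)"
    and Int: "\<And>i j. i \<in> {1..k} \<Longrightarrow> j \<in> {1..k} \<Longrightarrow> i \<noteq> j \<Longrightarrow> set (V i) \<inter> set (V j) = {c}"
    and W: "set Ws = V ` {1..k}"
  shows "wedge_of_spheres (CARD('n) - 1) k homeomorphic_space
         geometric_realization (complex_of (concat (map boundary_facets Ws)))"
proof -
  let ?Y = "geometric_realization (complex_of (concat (map boundary_facets Ws)))"
  define P where "P i = realization_points (complex_of (boundary_facets (V i)))" for i
  have Y: "topspace ?Y = (\<Union>i\<in>{1..k}. P i)"
    using W by (simp add: geometric_realization_eq realization_complex_of_concat P_def)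
  have sub: "subtopology ?Y (P i) = geometric_realization (complex_of (boundary_facets (V i)))"
    if "i \<in> {1..k}" for i
  proof -
    have "P i \<subseteq> topspace ?Y" using Y that by blast
    then show ?thesis unfolding P_def
      by (intro subtopology_geometric_realization) (simp add: geometric_realization_eq)
  qed
  have "\<forall>i\<in>{1..k}. \<exists>h. homeomorphic_map (nsphere (CARD('n) - 1)) (subtopology ?Y (P i)) h \<and>
      h sphere_base = vertex_point c"
  proof
    fix i assume i: "i \<in> {1..k}"
    then show "\<exists>h. homeomorphic_map (nsphere (CARD('n) - 1)) (subtopology ?Y (P i)) h \<and>
        h sphere_base = vertex_point c"
      unfolding sub[OF i] using V[OF i] by (intro pointed_sphere_boundary) auto
  qed
  then obtain h where h: "\<forall>i\<in>{1..k}. homeomorphic_map (nsphere (CARD('n) - 1)) (subtopology ?Y (P i)) (h i) \<and>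
      h i sphere_base = vertex_point c"
    by (rule bchoice[THEN exE])
  have ne: "set (V i) \<noteq> {c}" if "i \<in> {1..k}" for i using V[OF that] by auto
  have "P i \<inter> P j = {vertex_point c}" if ij: "i \<in> {1..k}" "j \<in> {1..k}" "i \<noteq> j" for i j
    using realization_boundary_Int[of "V i" "V j" c] ne[OF ij(1)] ne[OF ij(2)] Int[OF ij]
    by (simp add: P_def)
  moreover have "compact_space (nsphere (CARD('n) - 1))"
    using compact_space_nsphere[where 'a = "real^'n"] by simp
  ultimately show ?thesis
    unfolding wedge_of_spheres_def
    using h sphere_base_in_nsphere Hausdorff_geometric_realization Y
    by (intro wedge_sum_homeomorphic_space[where h = h and c = "vertex_point c" and P = P]) auto
qed

lemma homotopy_equivalent_homeomorphic_trans:
  "X homotopy_equivalent_space A \<Longrightarrow> B homeomorphic_space A \<Longrightarrow> X homotopy_equivalent_space B"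
  using homotopy_eqv_trans[of X A B] homeomorphic_imp_homotopy_equivalent_space[of A B]
    homeomorphic_space_sym[of A B] by blast

lemma circulant_wedge_circle:
  assumes "m = 7 \<or> m = 9"
  shows "geometric_realization (complex_of (circulant_facets m)) homotopy_equivalent_space wedge_of_spheres 1 1"
proof -
  have "wedge_of_spheres (CARD(2) - 1) 1 homeomorphic_space
     geometric_realization (complex_of (concat (map boundary_facets [[c, 0, b]])))"
    if "c \<noteq> 0" "c \<noteq> b" "b \<noteq> 0" for b c :: nat
    using that by (intro wedge_of_boundaries[where V = "\<lambda>_. [c, 0, b]" and c = 0]) auto
  from this[of 7 2] this[of 9 6]
  have "wedge_of_spheres 1 1 homeomorphic_space
     geometric_realization (complex_of (concat (map boundary_facets [[7, 0, 2 :: nat]])))"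
    "wedge_of_spheres 1 1 homeomorphic_space
     geometric_realization (complex_of (concat (map boundary_facets [[9, 0, 6 :: nat]])))"
    by simp_all
  from homotopy_equivalent_homeomorphic_trans[OF circulant_facets_7 this(1)]
    homotopy_equivalent_homeomorphic_trans[OF circulant_facets_9 this(2)]
  show ?thesis using assms by (elim disjE) simp_all
qed

lemma circulant_wedge_two_spheres:
  "geometric_realization (complex_of (circulant_facets 6)) homotopy_equivalent_space wedge_of_spheres 2 2"
proof -
  let ?V = "\<lambda>i::nat. if i = 1 then [0, 1, 2, 6] else [2, 4, 5, 7 :: nat]"
  have "{1..2} = {1, 2 :: nat}" by auto
  then have "wedge_of_spheres (CARD(3) - 1) 2 homeomorphic_space
     geometric_realization (complex_of (concat (map boundary_facets [[0, 1, 2, 6], [2, 4, 5, 7 :: nat]])))"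
    by (intro wedge_of_boundaries[where V = ?V and c = 2]) auto
  then have "wedge_of_spheres 2 2 homeomorphic_space
     geometric_realization (complex_of (concat (map boundary_facets [[0, 1, 2, 6], [2, 4, 5, 7 :: nat]])))"
    by simp
  with circulant_facets_6 show ?thesis by (rule homotopy_equivalent_homeomorphic_trans)
qed

lemma boundary_homeomorphic_nsphere_2:
  assumes "card (set vs) = 4"
  shows "geometric_realization (complex_of (boundary_facets vs)) homeomorphic_space nsphere 2"
proof -
  obtain c where "c \<in> set vs" using assms by fastforce
  then obtain h where "homeomorphic_map (nsphere 2) (geometric_realization (complex_of (boundary_facets vs))) h"
    using pointed_sphere_boundary[of vs c, where 'n = 3] assms by auto
  then have "nsphere 2 homeomorphic_space geometric_realization (complex_of (boundary_facets vs))"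
    by (rule homeomorphic_map_imp_homeomorphic_space)
  then show ?thesis by (rule homeomorphic_space_sym[THEN iffD1])
qed

lemma circulant_garland:
  "\<exists>Y :: (nat \<Rightarrow> real) topology. garland_of_2_spheres Y \<and>
     geometric_realization (complex_of (circulant_facets 10)) homotopy_equivalent_space Y"
proof (intro exI conjI)
  define Vs :: "nat list list" where
    "Vs = [[10, 0, 5, 1], [11, 1, 6, 2], [12, 2, 7, 3], [13, 3, 8, 4], [14, 4, 9, 5]]"
  define X where "X i = realization_points (complex_of (boundary_facets (Vs ! (i - 1))))" for i
  let ?Y = "geometric_realization (complex_of (concat (map boundary_facets Vs)))"
  show "geometric_realization (complex_of (circulant_facets 10)) homotopy_equivalent_space ?Y"
    unfolding Vs_def by (rule circulant_facets_10)
  have five: "{1..5} = {1, 2, 3, 4, 5 :: nat}" by auto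
  have V: "Vs ! (1 - 1) = [10, 0, 5, 1]" "Vs ! (2 - 1) = [11, 1, 6, 2]" "Vs ! (3 - 1) = [12, 2, 7, 3]"
    "Vs ! (4 - 1) = [13, 3, 8, 4]" "Vs ! (5 - 1) = [14, 4, 9, 5]"
    by (simp_all add: Vs_def)
  have top: "topspace ?Y = (\<Union>i\<in>{1..5}. X i)"
    unfolding five X_def geometric_realization_eq
    by (simp add: realization_complex_of_concat V[simplified]) (simp add: Vs_def)
  have sub: "subtopology ?Y (X i) = geometric_realization (complex_of (boundary_facets (Vs ! (i - 1))))"
    if "i \<in> {1..5}" for i
  proof -
    have "X i \<subseteq> topspace ?Y" using top that by blast
    then show ?thesis unfolding X_def
      by (intro subtopology_geometric_realization) (simp add: geometric_realization_eq)
  qed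
  have card4: "card (set (Vs ! (i - 1))) = 4" if "i \<in> {1..5}" for i
    using that unfolding five by (auto simp: V[simplified])
  have Int: "X i \<inter> X j = vertex_point ` (set (Vs ! (i - 1)) \<inter> set (Vs ! (j - 1)))"
    if "i \<in> {1..5}" "j \<in> {1..5}" "set (Vs ! (i - 1)) \<inter> set (Vs ! (j - 1)) \<subseteq> {c}" for i j c
    unfolding X_def
    by (rule realization_boundary_Int[OF that(3)]) (use card4[OF that(1)] card4[OF that(2)] in auto)
  have "garland ?Y 5 X"
    unfolding garland_def
  proof (intro conjI ballI impI)
    fix i j :: nat assume ij: "i \<in> {1..5}" "j \<in> {1..5}" "i \<noteq> j"
    \<comment> \<open>Neighbouring spheres share exactly one vertex and it is one of 1, ..., 5, the
      vertex 5 closing the cycle; all other pairs are disjoint. Five instances of \<open>Int\<close>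
      thus decide every pair.\<close>
    show "if [int i - int j = 1] (mod int 5) \<or> [int i - int j = - 1] (mod int 5)
         then card (X i \<inter> X j) = 1 else X i \<inter> X j = {}"
      using ij Int[OF ij(1,2), of 1] Int[OF ij(1,2), of 2] Int[OF ij(1,2), of 3] Int[OF ij(1,2), of 4]
        Int[OF ij(1,2), of 5]
      unfolding five by (auto simp: V[simplified] cong_def)
  qed (use top in auto)
  moreover have "subtopology ?Y (X i) homeomorphic_space nsphere 2" if "i \<in> {1..5}" for i
    using boundary_homeomorphic_nsphere_2[OF card4[OF that]] sub[OF that] by simp
  ultimately show "garland_of_2_spheres ?Y"
    unfolding garland_of_2_spheres_def using Hausdorff_geometric_realization by blast
qed

lemma circulant_torus:
  assumes "11 \<le> m"
  shows "geometric_realization (complex_of (circulant_facets m)) homotopy_equivalent_space torus"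
  using collapse_to_torus_complex[OF assms] torus_complex_homeomorphic_torus[OF assms]
    homeomorphic_imp_homotopy_equivalent_space homotopy_eqv_trans by blast

lemma circulant_3_5_components:
  assumes a: "0 < a" "10 * a < n" "n \<noteq> 16 * a"
    and Z: "Z \<in> component_spaces (geometric_realization (neighborhood_complex (circulant_graph n (3 * a) (5 * a))))"
  shows "n = 20 * a \<Longrightarrow> \<exists>Y :: (nat \<Rightarrow> real) topology. garland_of_2_spheres Y \<and> Z homotopy_equivalent_space Y"
    and "n = 12 * a \<Longrightarrow> Z homotopy_equivalent_space wedge_of_spheres 2 2"
    and "n = 14 * a \<or> n = 18 * a \<Longrightarrow> Z homotopy_equivalent_space wedge_of_spheres 1 1"
    and "n \<notin> {12 * a, 14 * a, 18 * a, 20 * a} \<Longrightarrow> Z homotopy_equivalent_space torus"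
proof -
  define m where "m = n div gcd n (2 * a)"
  have Zm: "Z homotopy_equivalent_space geometric_realization (complex_of (circulant_facets m))"
    unfolding m_def
    by (intro homeomorphic_imp_homotopy_equivalent_space component_of_circulant a Z)
  have m_eq: "m = k" if "n = k * (2 * a)" for k
    using that a(1) by (simp add: m_def)
  show "\<exists>Y :: (nat \<Rightarrow> real) topology. garland_of_2_spheres Y \<and> Z homotopy_equivalent_space Y" if "n = 20 * a"
    using m_eq[of 10] that circulant_garland Zm homotopy_eqv_trans by auto
  show "Z homotopy_equivalent_space wedge_of_spheres 2 2" if "n = 12 * a"
    using m_eq[of 6] that circulant_wedge_two_spheres Zm homotopy_eqv_trans by auto
  show "Z homotopy_equivalent_space wedge_of_spheres 1 1" if "n = 14 * a \<or> n = 18 * a"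
    using m_eq[of 7] m_eq[of 9] that circulant_wedge_circle[of m] Zm homotopy_eqv_trans by auto
  show "Z homotopy_equivalent_space torus" if n: "n \<notin> {12 * a, 14 * a, 18 * a, 20 * a}"
  proof -
    define g where "g = gcd n (2 * a)"
    have nmg: "n = m * g" by (simp add: m_def g_def)
    have "11 \<le> m"
    proof (rule ccontr)
      assume "\<not> 11 \<le> m"
      then have m10: "m \<le> 10" by simp
      have "g dvd 2 * a" by (simp add: g_def)
      then obtain b where b: "2 * a = g * b" by (rule dvdE)
      have "b \<noteq> 0" using a(1) b by (metis mult_0_right mult_is_0 not_gr0 zero_neq_numeral)
      show False
      \<comment> \<open>If the gcd is all of \<open>2a\<close>, then \<open>n = 2am\<close> and
        every \<open>m\<close> from 6 to 10 hits an excluded value of \<open>n\<close>. Otherwise it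
        is at most \<open>a\<close>, and \<open>n = m * g\<close> is too small.\<close>
      proof (cases "b = 1")
        case True
        then have nm: "n = m * (2 * a)" using b nmg by simp
        then have "5 < m" using a(2) by (metis mult.assoc mult.commute mult_2 not_less
            mult_le_mono1 numeral_Bit0 numeral_plus_numeral)
        then have "m \<in> {6, 7, 8, 9, 10}" using m10 by auto
        then show False using nm n a(3) by auto
      next
        case False
        then have "2 \<le> b" using \<open>b \<noteq> 0\<close> by simp
        then have "g * 2 \<le> 2 * a" using b by (metis mult_le_mono2)
        then have "g \<le> a" by simp
        then have "n \<le> 10 * a" using nmg m10 mult_le_mono by blast
        then show False using a(2) by simp
      qed
    qed
    then show ?thesis using circulant_torus Zm homotopy_eqv_trans by blast
  qed
qed

lemma circulant_graph_commute: "circulant_graph n s t = circulant_graph n t s"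
  by (simp add: circulant_graph_def insert_commute)

theorem theorem2p4:
  fixes n s t :: nat and Z :: "(nat \<Rightarrow> real) topology"
  assumes "n \<ge> 5"
    and "s \<in> {1..n div 2}" and "t \<in> {1..n div 2}" and "s \<noteq> t"
    and "n \<notin> {2 * s, 2 * t, 2 * (s + t)}"
    and "3 * s \<noteq> t" and "3 * t \<noteq> s"
    and "3 * s = 5 * t \<or> 3 * t = 5 * s"
    and Z: "Z \<in> component_spaces (geometric_realization (neighborhood_complex (circulant_graph n s t)))"
  shows "((5 * s = 3 * t \<and> n = 4 * t) \<or> (5 * t = 3 * s \<and> n = 4 * s) \<longrightarrow>
           (\<exists>Y :: (nat \<Rightarrow> real) topology. garland_of_2_spheres Y \<and> Z homotopy_equivalent_space Y)) \<and>
         ((5 * s = 3 * t \<and> n = 4 * s) \<or> (5 * t = 3 * s \<and> n = 4 * t) \<longrightarrow>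
           Z homotopy_equivalent_space wedge_of_spheres 2 2) \<and>
         ((5 * s = 3 * t \<and> real n \<in> {6 * real s, 14 * real s / 3}) \<or>
          (5 * t = 3 * s \<and> real n \<in> {6 * real t, 14 * real t / 3}) \<longrightarrow>
           (\<exists>k\<ge>1. Z homotopy_equivalent_space wedge_of_spheres 1 k)) \<and>
         ((5 * s = 3 * t \<and> real n \<notin> {4 * real s, 6 * real s, 14 * real s / 3, 4 * real t}) \<or>
          (5 * t = 3 * s \<and> real n \<notin> {4 * real t, 6 * real t, 14 * real t / 3, 4 * real s}) \<longrightarrow>
           (\<exists>T. connected_sum_of_tori T \<and> Z homotopy_equivalent_space T))"
proof -
  have param: "\<exists>a. x = 3 * a \<and> y = 5 * a" if "3 * y = 5 * x" for x y :: nat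
  proof -
    have "3 dvd 5 * x" using that by (metis dvd_triv_left)
    then have "3 dvd x" by presburger
    then obtain a where "x = 3 * a" by (rule dvdE)
    then show ?thesis using that by auto
  qed
  obtain a where a: "s = 3 * a \<and> t = 5 * a \<or> s = 5 * a \<and> t = 3 * a"
    using assms(8) param[of s t] param[of t s] by blast
  have a0: "0 < a" using a assms(2) by auto
  have "10 * a \<le> n" "n \<noteq> 10 * a" using a assms(2,3,5) by auto
  then have an: "10 * a < n" by simp
  have an16: "n \<noteq> 16 * a" using a assms(5) by auto
  have "Z \<in> component_spaces (geometric_realization
      (neighborhood_complex (circulant_graph n (3 * a) (5 * a))))"
    using a Z circulant_graph_commute[of n "5 * a" "3 * a"] by (elim disjE) simp_all
  note comp = circulant_3_5_components[OF a0 an an16 this]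
  \<comment> \<open>A single torus is enough for (D), and likewise one circle for (C).\<close>
  have torus: "connected_sum_of_tori torus" by (intro single homeomorphic_space_refl)
  \<comment> \<open>The cases in terms of \<open>a\<close>, with \<open>3a\<close> the smaller and
    \<open>5a\<close> the larger parameter; the fraction \<open>14 / 3\<close> becomes integral
    because the smaller one is divisible by 3.\<close>
  have eqs: "real n = 6 * real (3 * a) \<longleftrightarrow> n = 18 * a" "real n = 14 * real (3 * a) / 3 \<longleftrightarrow> n = 14 * a"
    "real n = 4 * real (3 * a) \<longleftrightarrow> n = 12 * a" "real n = 4 * real (5 * a) \<longleftrightarrow> n = 20 * a"
    by linarith+
  show ?thesis
    using a
  proof
    assume st: "s = 3 * a \<and> t = 5 * a"
    show ?thesis
      using comp a0 torus unfolding conjunct1[OF st] conjunct2[OF st] insert_iff eqs by auto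
  next
    assume st: "s = 5 * a \<and> t = 3 * a"
    show ?thesis
      using comp a0 torus unfolding conjunct1[OF st] conjunct2[OF st] insert_iff eqs by auto
  qed
qed

end
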